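(* Let $\alpha>0$ be any ordinal and let $\mathfrak{F}$ be a real closed $\eta_\alpha$-field of cardinality $\aleph_\alpha$. Then $\mathfrak{F}$ contains a proper copy of itself; that is, there is a proper subfield $\mathfrak{F}'\subsetneq\mathfrak{F}$ that is isomorphic to $\mathfrak{F}$.
   Context: A totally ordered set $S$ is an $\eta_\alpha$-set if for all subsets $A,B\subseteq S$ of cardinality less than $\aleph_\alpha$ with $a<b$ for all $a\in A$, $b\in B$, there is $x\in S$ with $a<x<b$ for all $a\in A$, $b\in B$ (where $A$ or $B$ may be empty). A real closed $\eta_\alpha$-field is a real closed field which, with its unique field order, is an $\eta_\alpha$-set. *)

theory Defs
  imports "HOL-Computational_Algebra.Polynomial"
begin

unbundle cardinal_syntax

(* Ordinals are represented by well-orders and cardinals by cardinal orders (Card_order), as in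
   HOL's BNF cardinal library; the underlying set is the Field of the relation. *)

(* The quantified cardinals l range over cardinal orders on subsets of the type of k only.
   Every cardinal at most k has a representative there, so k is least among all cardinals. *)
definition least_infinite_cardinal_above :: "'a rel set \<Rightarrow> 'a rel \<Rightarrow> bool" where
  "least_infinite_cardinal_above M k \<longleftrightarrow>
     Card_order k \<and> infinite (Field k) \<and> (\<forall>m\<in>M. m <o k) \<and>
     (\<forall>l :: 'a rel. Card_order l \<and> infinite (Field l) \<and> (\<forall>m\<in>M. m <o l) \<longrightarrow> k \<le>o l)"

(* "k is aleph_alpha", by transfinite recursion along the well-order alpha: for all ordinals
   beta up to and including alpha, aleph_beta is the least infinite cardinal above all
   aleph_gamma with gamma < beta.  An element i of Field alpha stands for the ordinal beta < alpha
   that is the order type of its strict predecessors, and h i is aleph_beta. *)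
definition is_aleph :: "'b rel \<Rightarrow> 'a rel \<Rightarrow> bool" where
  "is_aleph \<alpha> k \<longleftrightarrow>
     Well_order \<alpha> \<and>
     (\<exists>h :: 'b \<Rightarrow> 'a rel.
        (\<forall>i\<in>Field \<alpha>. least_infinite_cardinal_above (h ` underS \<alpha> i) (h i)) \<and>
        least_infinite_cardinal_above (h ` Field \<alpha>) k)"

(* The eta_alpha property, with the cardinal k in the role of aleph_alpha. *)
definition eta_set :: "'c rel \<Rightarrow> 'a::linorder set \<Rightarrow> bool" where
  "eta_set k S \<longleftrightarrow>
     (\<forall>A B. A \<subseteq> S \<and> B \<subseteq> S \<and> |A| <o k \<and> |B| <o k \<and> (\<forall>a\<in>A. \<forall>b\<in>B. a < b) \<longrightarrow>
        (\<exists>x\<in>S. (\<forall>a\<in>A. a < x) \<and> (\<forall>b\<in>B. x < b)))"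

(* Nonnegative elements are squares, so the order of the class linordered_field
   is the only field order on 'a. *)
definition real_closed :: "'a::linordered_field itself \<Rightarrow> bool" where
  "real_closed _ \<longleftrightarrow>
     (\<forall>x::'a. 0 \<le> x \<longrightarrow> (\<exists>y. y ^ 2 = x)) \<and>
     (\<forall>p :: 'a poly. odd (degree p) \<longrightarrow> (\<exists>x. poly p x = 0))"

definition is_subfield :: "'a::field set \<Rightarrow> bool" where
  "is_subfield K \<longleftrightarrow>
     0 \<in> K \<and> 1 \<in> K \<and>
     (\<forall>x\<in>K. \<forall>y\<in>K. x + y \<in> K \<and> x * y \<in> K) \<and>
     (\<forall>x\<in>K. - x \<in> K \<and> inverse x \<in> K)"

definition field_iso :: "('a::field \<Rightarrow> 'b::field) \<Rightarrow> 'a set \<Rightarrow> 'b set \<Rightarrow> bool" where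
  "field_iso \<phi> K L \<longleftrightarrow>
     bij_betw \<phi> K L \<and> \<phi> 1 = 1 \<and>
     (\<forall>x\<in>K. \<forall>y\<in>K. \<phi> (x + y) = \<phi> x + \<phi> y \<and> \<phi> (x * y) = \<phi> x * \<phi> y)"

end

theory Submission
  imports Defs "HOL-Algebra.Algebraic_Closure_Type" "HOL-Algebra.Free_Abelian_Groups"
    "HOL-Computational_Algebra.Polynomial_FPS" "HOL-Library.Product_Plus"
begin

hide_const (open) Polynomials.degree Polynomials.lead_coeff up_ring.coeff up_ring.monom Module.smult Coset.order
no_notation var (\<open>X\<index>\<close>)

text \<open>
  Write \<open>F\<close> for the given field. An order embedding of \<open>F\<close> into itself is built by transfinite
  recursion along a well-order of \<open>F\<close> of type \<open>\<kappa>\<close>, one value at a time, and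
  some element \<open>t\<close> is kept out of its image, so that the image is a proper subfield.

  A stage of the recursion is a set \<open>P\<close> of fewer than \<open>\<kappa>\<close> argument-value pairs. It is represented as a
  subset of the product ring \<open>F \<times> F\<close>: the pairs extend to an order isomorphism between the subrings
  generated by the arguments and by the values iff in the subring of \<open>F \<times> F\<close> generated by \<open>P\<close> both
  components of an element always have the same sign (\<open>coherent\<close>). A polynomial whose coefficients are
  pairs in a coherent subring is a polynomial together with its image under the isomorphism.

  To extend the map to \<open>x\<close> (\<open>extendible_insert\<close>), first enlarge the coherent subring, inside the
  relatively algebraically closed subfields generated by arguments and values, to a maximal one, \<open>G\<close>. By
  the argument for the uniqueness of real closures, both projections of \<open>G\<close> then contain all roots
  in \<open>F\<close> of polynomials over \<open>G\<close> (\<open>maximal_coherent_contains_roots\<close>). For an element \<open>r\<close> of least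
  degree over the first projection, or dually over the second, all critical points of its polynomial \<open>p\<close>
  lie in the projections already, \<open>p\<close> is monotone between two of them, and so the intermediate value
  theorem gives a counterpart of \<open>r\<close> on the other side in the right place. If \<open>x\<close> is still not covered,
  its type over \<open>G\<close> is determined by the cut that it makes (\<open>sign_transfer\<close>), and the \<open>\<eta>\<close>-property yields
  some \<open>y\<close> in the corresponding cut. Applied to a larger left class, the same property gives a \<open>y\<close> that
  avoids any prescribed set of fewer than \<open>\<kappa>\<close> elements. Choosing \<open>y\<close> transcendental over the values
  together with \<open>t\<close>, the exchange property of algebraic dependence (\<open>rac_exchange\<close>) shows that \<open>t\<close> remains
  transcendental over the values. All the algebraic closures involved are smaller than \<open>\<kappa>\<close> because \<open>\<kappa>\<close> is
  uncountable; this is where \<open>\<alpha> > 0\<close> enters. Unions of chains of stages cause no difficulty since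
  coherence and algebraic dependence are of finite character.

  The intermediate value theorem has to be derived from the existence of square roots and of roots of
  polynomials of odd degree. This is Laplace's proof of the fundamental theorem of algebra
  (\<open>laplace_root\<close>), with Newton's identities in the place of the theorem on symmetric polynomials.
\<close>

section \<open>Polynomials with coefficients in a subring\<close>

definition is_subring :: "'a::comm_ring_1 set \<Rightarrow> bool" where
  "is_subring S \<longleftrightarrow> 0 \<in> S \<and> 1 \<in> S \<and> (\<forall>x\<in>S. \<forall>y\<in>S. x + y \<in> S \<and> x * y \<in> S) \<and> (\<forall>x\<in>S. - x \<in> S)"

definition polys_over :: "'a::zero set \<Rightarrow> 'a poly set" where
  "polys_over S = {p. \<forall>i. coeff p i \<in> S}"


lemma is_subfield_imp_is_subring: "is_subfield K \<Longrightarrow> is_subring K"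
  by (simp add: is_subring_def is_subfield_def)

lemma subfield_divide: "is_subfield K \<Longrightarrow> x \<in> K \<Longrightarrow> y \<in> K \<Longrightarrow> x / y \<in> K"
  by (simp add: is_subfield_def divide_inverse)

lemma is_subringD:
  assumes "is_subring S"
  shows "0 \<in> S" "1 \<in> S" "x \<in> S \<Longrightarrow> y \<in> S \<Longrightarrow> x + y \<in> S" "x \<in> S \<Longrightarrow> y \<in> S \<Longrightarrow> x * y \<in> S"
    "x \<in> S \<Longrightarrow> - x \<in> S" "x \<in> S \<Longrightarrow> y \<in> S \<Longrightarrow> x - y \<in> S"
proof -
  show "0 \<in> S" "1 \<in> S" "x \<in> S \<Longrightarrow> y \<in> S \<Longrightarrow> x + y \<in> S" "x \<in> S \<Longrightarrow> y \<in> S \<Longrightarrow> x * y \<in> S"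
    "x \<in> S \<Longrightarrow> - x \<in> S"
    using assms by (auto simp: is_subring_def)
  show "x - y \<in> S" if "x \<in> S" "y \<in> S"
  proof -
    have "x + (- y) \<in> S" using assms that unfolding is_subring_def by blast
    then show ?thesis by simp
  qed
qed

lemma subring_sum: "is_subring S \<Longrightarrow> (\<And>x. x \<in> A \<Longrightarrow> f x \<in> S) \<Longrightarrow> sum f A \<in> S"
  by (induction A rule: infinite_finite_induct) (auto intro: is_subringD)


lemma subring_power: "is_subring S \<Longrightarrow> x \<in> S \<Longrightarrow> x ^ n \<in> S"
  by (induction n) (auto intro: is_subringD)

lemma subring_of_nat: "is_subring S \<Longrightarrow> of_nat n \<in> S"
  by (induction n) (auto intro: is_subringD)

lemma polys_over_coeff: "p \<in> polys_over S \<Longrightarrow> coeff p i \<in> S"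
  by (simp add: polys_over_def)

lemma pCons_in_polys_over_iff: "pCons a p \<in> polys_over S \<longleftrightarrow> a \<in> S \<and> p \<in> polys_over S"
proof -
  have "(\<forall>i. coeff (pCons a p) i \<in> S) \<longleftrightarrow> a \<in> S \<and> (\<forall>i. coeff p i \<in> S)"
    by (metis coeff_pCons_0 coeff_pCons_Suc not0_implies_Suc)
  then show ?thesis by (simp add: polys_over_def)
qed

lemma polys_over_mono: "S \<subseteq> T \<Longrightarrow> polys_over S \<subseteq> polys_over T"
  by (auto simp: polys_over_def)

lemma is_subring_polys_over:
  assumes "is_subring S"
  shows "is_subring (polys_over S)"
  unfolding is_subring_def polys_over_def
  using assms
  by (auto simp: coeff_mult coeff_1 intro!: is_subringD subring_sum)

lemma zero_in_polys_over: "0 \<in> S \<Longrightarrow> 0 \<in> polys_over S"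
  by (simp add: polys_over_def)

lemma monom_in_polys_over: "0 \<in> S \<Longrightarrow> c \<in> S \<Longrightarrow> monom c n \<in> polys_over S"
  by (simp add: polys_over_def)

lemma smult_in_polys_over: "is_subring S \<Longrightarrow> c \<in> S \<Longrightarrow> p \<in> polys_over S \<Longrightarrow> smult c p \<in> polys_over S"
  by (simp add: polys_over_def is_subringD)


lemma poly_in_subring: 
  assumes "is_subring S" "x \<in> S"
  shows "p \<in> polys_over S \<Longrightarrow> poly p x \<in> S"
proof (induction p)
  case 0
  then show ?case using assms by (simp add: is_subringD)
next
  case (pCons a p)
  then show ?case using assms by (auto simp: pCons_in_polys_over_iff intro!: is_subringD)
qed

definition adjoin :: "'a::comm_ring_1 set \<Rightarrow> 'a \<Rightarrow> 'a set" where
  "adjoin S z = (\<lambda>p. poly p z) ` polys_over S"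

lemma adjoinI: "p \<in> polys_over S \<Longrightarrow> poly p z \<in> adjoin S z"
  by (simp add: adjoin_def)

lemma adjoinE:
  assumes "x \<in> adjoin S z"
  obtains p where "p \<in> polys_over S" "x = poly p z"
  using assms by (auto simp: adjoin_def)

lemma is_subring_adjoin:
  assumes S: "is_subring S"
  shows "is_subring (adjoin S z)"
  unfolding is_subring_def
proof (intro conjI ballI)
  note P = is_subringD[OF is_subring_polys_over[OF S]]
  show "0 \<in> adjoin S z" "1 \<in> adjoin S z"
    using adjoinI[OF P(1), of z] adjoinI[OF P(2), of z] by simp_all
  fix a assume "a \<in> adjoin S z"
  then obtain p where p: "p \<in> polys_over S" "a = poly p z" by (rule adjoinE)
  then show "- a \<in> adjoin S z" using adjoinI[OF P(5)[of p], of z] by simp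
  fix b assume "b \<in> adjoin S z"
  then obtain q where q: "q \<in> polys_over S" "b = poly q z" by (rule adjoinE)
  show "a + b \<in> adjoin S z" "a * b \<in> adjoin S z"
    using adjoinI[OF P(3)[of p q], of z] adjoinI[OF P(4)[of p q], of z] p q by simp_all
qed

lemma insert_subset_adjoin:
  assumes "is_subring S"
  shows "insert z S \<subseteq> adjoin S z"
proof -
  have "[:0, 1:] \<in> polys_over S" "c \<in> S \<Longrightarrow> [:c:] \<in> polys_over S" for c
    using is_subringD[OF assms] by (auto simp: pCons_in_polys_over_iff zero_in_polys_over)
  then have "poly [:0, 1:] z \<in> adjoin S z" "c \<in> S \<Longrightarrow> poly [:c:] z \<in> adjoin S z" for c
    by (blast intro: adjoinI)+
  then show ?thesis by auto
qed

lemma adjoin_minimal: "is_subring T \<Longrightarrow> S \<subseteq> T \<Longrightarrow> z \<in> T \<Longrightarrow> adjoin S z \<subseteq> T"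
  using polys_over_mono[of S T] by (auto simp: adjoin_def intro!: poly_in_subring)

lemma synthetic_div_in_polys_over:
  assumes "is_subring S" "c \<in> S"
  shows "p \<in> polys_over S \<Longrightarrow> synthetic_div p c \<in> polys_over S"
proof (induction p)
  case 0
  then show ?case by simp
next
  case (pCons a p)
  then show ?case using assms poly_in_subring[OF assms]
    by (auto simp: pCons_in_polys_over_iff synthetic_div_pCons)
qed

lemma
  fixes h :: "'a::comm_semiring_1 \<Rightarrow> 'b::comm_semiring_1"
  assumes "h 0 = 0" "\<And>x y. h (x + y) = h x + h y" "\<And>x y. h (x * y) = h x * h y"
  shows map_poly_hom_add: "map_poly h (p + q) = map_poly h p + map_poly h q"
    and map_poly_hom_mult: "map_poly h (p * q) = map_poly h p * map_poly h q"
    and poly_map_poly_hom: "poly (map_poly h p) (h x) = h (poly p x)"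
proof -
  have sum: "h (sum f A) = (\<Sum>x\<in>A. h (f x))" for f :: "nat \<Rightarrow> 'a" and A
    by (induction A rule: infinite_finite_induct) (auto simp: assms)
  show "map_poly h (p + q) = map_poly h p + map_poly h q"
    by (rule poly_eqI) (simp add: coeff_map_poly assms)
  show "map_poly h (p * q) = map_poly h p * map_poly h q"
    by (rule poly_eqI) (simp add: coeff_map_poly assms coeff_mult sum)
  show "poly (map_poly h p) (h x) = h (poly p x)"
    by (induction p) (auto simp: map_poly_pCons assms)
qed

section \<open>Newton's identities\<close>

text \<open>
  The product is the reversed polynomial \<open>R\<close> with the roots \<open>\<beta> i\<close>, and the power series on the right is
  minus its logarithmic derivative: each factor \<open>1 - \<beta> X\<close> contributes a geometric series. Passing to
  power series makes the identities uniform in the degree, also beyond the number of roots.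
\<close>

lemma newton_identities_fps:
  fixes \<beta> :: "'i \<Rightarrow> 'a::field"
  assumes "finite I"
  defines "R \<equiv> \<lambda>J. (\<Prod>i\<in>J. 1 - fps_const (\<beta> i) * fps_X)"
  shows "fps_deriv (R I) = - R I * Abs_fps (\<lambda>m. \<Sum>i\<in>I. \<beta> i ^ Suc m)"
  using assms(1)
proof (induction I)
  case empty
  show ?case by (simp add: R_def fps_eq_iff)
next
  case (insert j J)
  let ?g = "Abs_fps (\<lambda>m. \<beta> j ^ Suc m)"
  let ?l = "1 - fps_const (\<beta> j) * fps_X"
  have geo: "?l * ?g = fps_const (\<beta> j)"
    by (rule fps_ext) (auto simp: algebra_simps fps_mult_fps_X_commute[symmetric] gr0_conv_Suc)
  have R: "R (insert j J) = ?l * R J" using insert by (simp add: R_def)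
  have T: "Abs_fps (\<lambda>m. \<Sum>i\<in>insert j J. \<beta> i ^ Suc m) = ?g + Abs_fps (\<lambda>m. \<Sum>i\<in>J. \<beta> i ^ Suc m)"
    using insert by (auto simp: fps_eq_iff)
  have "fps_deriv (R (insert j J)) = ?l * fps_deriv (R J) - fps_const (\<beta> j) * R J"
    unfolding R by (simp add: algebra_simps)
  also have "\<dots> = ?l * fps_deriv (R J) - ?l * ?g * R J"
    by (simp only: geo)
  also have "\<dots> = - R (insert j J) * (?g + Abs_fps (\<lambda>m. \<Sum>i\<in>J. \<beta> i ^ Suc m))"
    unfolding insert.IH R by (simp add: algebra_simps)
  finally show ?case unfolding T .
qed

lemma newton_identities:
  fixes \<beta> :: "'i \<Rightarrow> 'a::field"
  assumes "finite I"
  defines "r \<equiv> coeff (reflect_poly (\<Prod>i\<in>I. [:- \<beta> i, 1:]))"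
  shows "of_nat (Suc d) * r (Suc d) = - (\<Sum>k\<le>d. r k * (\<Sum>i\<in>I. \<beta> i ^ Suc (d - k)))"
proof -
  let ?R = "\<Prod>i\<in>I. 1 - fps_const (\<beta> i) * fps_X"
  have refl: "reflect_poly (\<Prod>i\<in>I. [:- \<beta> i, 1:]) = (\<Prod>i\<in>I. [:1, - \<beta> i:])"
    unfolding reflect_poly_prod
  proof (rule prod.cong[OF refl])
    fix i
    show "reflect_poly [:- \<beta> i, 1:] = [:1, - \<beta> i:]"
      by (cases "\<beta> i = 0") (auto simp: reflect_poly_pCons' poly_eq_iff coeff_pCons split: nat.splits)
  qed
  have "fps_of_poly (\<Prod>i\<in>I. [:1, - \<beta> i:]) = ?R"
    unfolding fps_of_poly_prod
    by (rule prod.cong) (auto simp: fps_of_poly_pCons)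
  then have r: "r k = fps_nth ?R k" for k
    unfolding r_def refl by (metis fps_of_poly_nth)
  have "of_nat (Suc d) * fps_nth ?R (Suc d) = fps_nth (fps_deriv ?R) d" by simp
  also have "\<dots> = - (\<Sum>k\<le>d. fps_nth ?R k * (\<Sum>i\<in>I. \<beta> i ^ Suc (d - k)))"
    unfolding newton_identities_fps[OF assms(1)]
    by (simp add: fps_mult_nth atLeast0AtMost del: power_Suc)
  finally show ?thesis unfolding r .
qed

lemma polys_over_reflect_iff:
  assumes "0 \<in> S"
  shows "p \<in> polys_over S \<longleftrightarrow> (\<forall>d. coeff (reflect_poly p) d \<in> S)"
proof
  assume "\<forall>d. coeff (reflect_poly p) d \<in> S"
  then have *: "coeff (reflect_poly p) (degree p - i) \<in> S" for i by blast
  show "p \<in> polys_over S" unfolding polys_over_def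
  proof safe
    fix i
    show "coeff p i \<in> S"
      using *[of i] assms 
      by (cases "i \<le> degree p") (auto simp: coeff_reflect_poly coeff_eq_0 split: if_splits)
  qed
qed (use assms in \<open>auto simp: polys_over_def coeff_reflect_poly\<close>)

text \<open>
  Newton's identities determine the coefficients recursively from the power sums and conversely; in
  characteristic zero neither recursion leaves the subfield. This replaces the fundamental theorem on
  symmetric polynomials: to see that a polynomial whose roots are built symmetrically has coefficients in
  \<open>S\<close>, it suffices to compute the power sums of these roots.
\<close>

lemma polys_over_iff_power_sums:
  fixes \<beta> :: "'i \<Rightarrow> 'a::field_char_0"
  assumes "finite I" and S: "is_subfield S"
  shows "(\<Prod>i\<in>I. [:- \<beta> i, 1:]) \<in> polys_over S \<longleftrightarrow> (\<forall>m. (\<Sum>i\<in>I. \<beta> i ^ m) \<in> S)"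
proof -
  note R = is_subringD[OF is_subfield_imp_is_subring[OF S]]
    subring_sum[OF is_subfield_imp_is_subring[OF S]] subring_of_nat[OF is_subfield_imp_is_subring[OF S]]
  define p where "p = (\<Prod>i\<in>I. [:- \<beta> i, 1:])"
  define r where "r = coeff (reflect_poly p)"
  define s where "s m = (\<Sum>i\<in>I. \<beta> i ^ m)" for m
  have N: "of_nat (Suc d) * r (Suc d) = - (\<Sum>k\<le>d. r k * s (Suc (d - k)))" for d
    using newton_identities[OF assms(1), of d \<beta>] by (simp add: r_def p_def s_def)
  have "lead_coeff p = 1" unfolding p_def lead_coeff_prod by simp
  then have r0: "r 0 = 1" by (simp add: r_def)
  have "(\<forall>d. r d \<in> S) \<longleftrightarrow> (\<forall>m. s m \<in> S)"
  proof safe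
    fix m assume r: "\<forall>d. r d \<in> S"
    show "s m \<in> S"
    proof (induction m rule: less_induct)
      case (less m)
      show ?case
      proof (cases m)
        case 0
        then show ?thesis using R by (auto simp: s_def)
      next
        case (Suc d)
        have "{..d} = insert 0 {1..d}" by auto
        then have "of_nat (Suc d) * r (Suc d) = - (s (Suc d) + (\<Sum>k\<in>{1..d}. r k * s (Suc (d - k))))"
          unfolding N by (simp add: r0)
        then have "s (Suc d) = - (of_nat (Suc d) * r (Suc d)) - (\<Sum>k\<in>{1..d}. r k * s (Suc (d - k)))"
          by (simp only:) simp
        also have "\<dots> \<in> S"
          using less[unfolded Suc] r by (intro R(6) R(5) R(4) R(7) R(8)) auto
        finally show ?thesis unfolding Suc .
      qed
    qed
  next
    fix d assume s: "\<forall>m. s m \<in> S"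
    show "r d \<in> S"
    proof (induction d rule: less_induct)
      case (less n)
      show ?case
      proof (cases n)
        case 0
        then show ?thesis using R r0 by auto
      next
        case (Suc d)
        have "r (Suc d) = - (\<Sum>k\<le>d. r k * s (Suc (d - k))) / of_nat (Suc d)"
          unfolding N[symmetric] by (simp del: of_nat_Suc)
        also have "\<dots> \<in> S"
          using less[unfolded Suc] s by (intro subfield_divide[OF S] R(5) R(7) R(4) R(8)) auto
        finally show ?thesis unfolding Suc .
      qed
    qed
  qed
  then show ?thesis
    using R(1) unfolding p_def[symmetric] polys_over_reflect_iff[OF R(1)] r_def s_def by simp
qed

section \<open>Laplace's proof of the fundamental theorem of algebra\<close>

definition index_pairs :: "nat \<Rightarrow> (nat \<times> nat) set" where
  "index_pairs n = {(i, j). i < j \<and> j < n}"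

lemma finite_index_pairs: "finite (index_pairs n)"
  by (rule finite_subset[of _ "{..<n} \<times> {..<n}"]) (auto simp: index_pairs_def)

lemma sum_symmetric_function:
  fixes f :: "nat \<Rightarrow> nat \<Rightarrow> 'a::comm_semiring_1"
  assumes "\<And>i j. f i j = f j i"
  shows "(\<Sum>i<n. \<Sum>j<n. f i j) = 2 * (\<Sum>(i, j)\<in>index_pairs n. f i j) + (\<Sum>i<n. f i i)"
proof (induction n)
  case 0
  show ?case by (simp add: index_pairs_def)
next
  case (Suc n)
  have I: "index_pairs (Suc n) = index_pairs n \<union> (\<lambda>i. (i, n)) ` {..<n}"
    by (auto simp: index_pairs_def less_Suc_eq)
  have "(\<Sum>(i, j)\<in>index_pairs (Suc n). f i j) = (\<Sum>(i, j)\<in>index_pairs n. f i j) + (\<Sum>(i, j)\<in>(\<lambda>i. (i, n)) ` {..<n}. f i j)"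
    unfolding I by (rule sum.union_disjoint) (auto simp: finite_index_pairs, auto simp: index_pairs_def)
  also have "(\<Sum>(i, j)\<in>(\<lambda>i. (i, n)) ` {..<n}. f i j) = (\<Sum>i<n. f i n)"
    by (subst sum.reindex) (auto simp: inj_on_def)
  finally have J: "(\<Sum>(i, j)\<in>index_pairs (Suc n). f i j) = (\<Sum>(i, j)\<in>index_pairs n. f i j) + (\<Sum>i<n. f i n)" .
  have "(\<Sum>i<Suc n. \<Sum>j<Suc n. f i j) = (\<Sum>i<n. \<Sum>j<n. f i j) + 2 * (\<Sum>i<n. f i n) + f n n"
  proof -
    have "(\<Sum>j<n. f n j) = (\<Sum>i<n. f i n)" by (intro sum.cong refl assms)
    then show ?thesis by (simp add: sum.distrib algebra_simps mult_2)
  qed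
  then show ?case unfolding Suc.IH J by (simp add: algebra_simps)
qed

lemma card_index_pairs: "n * n = 2 * card (index_pairs n) + n"
proof -
  have "(\<Sum>i<n. \<Sum>j<n. 1::nat) = 2 * (\<Sum>(i, j)\<in>index_pairs n. 1) + (\<Sum>i<n. 1)"
    by (rule sum_symmetric_function) (rule refl)
  then show ?thesis by (simp add: split_def)
qed

text \<open>
  The functions \<open>\<lambda>i j. g (\<alpha> i) (\<alpha> j)\<close> for a polynomial \<open>g\<close> in two variables with coefficients in \<open>S\<close>. They
  are needed for two closure properties only: products stay in the class, and their sums over all \<open>i\<close> and
  \<open>j\<close> reduce to power sums of the \<open>\<alpha> i\<close>.
\<close>

inductive bivariate :: "'a::comm_ring_1 set \<Rightarrow> ('i \<Rightarrow> 'a) \<Rightarrow> ('i \<Rightarrow> 'i \<Rightarrow> 'a) \<Rightarrow> bool" for S \<alpha> where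
  monomial: "c \<in> S \<Longrightarrow> bivariate S \<alpha> (\<lambda>i j. c * \<alpha> i ^ a * \<alpha> j ^ b)"
| add: "bivariate S \<alpha> f \<Longrightarrow> bivariate S \<alpha> g \<Longrightarrow> bivariate S \<alpha> (\<lambda>i j. f i j + g i j)"

lemma bivariate_mult:
  assumes S: "is_subring S"
  shows "bivariate S \<alpha> f \<Longrightarrow> bivariate S \<alpha> g \<Longrightarrow> bivariate S \<alpha> (\<lambda>i j. f i j * g i j)"
proof (induction rule: bivariate.induct)
  case (monomial c a b)
  from monomial(2) show ?case
  proof (induction rule: bivariate.induct)
    case (monomial c' a' b')
    have "bivariate S \<alpha> (\<lambda>i j. (c * c') * \<alpha> i ^ (a + a') * \<alpha> j ^ (b + b'))"
      using \<open>c \<in> S\<close> \<open>c' \<in> S\<close> by (intro bivariate.monomial is_subringD[OF S])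
    then show ?case by (simp add: power_add mult_ac)
  next
    case (add f g)
    then show ?case by (simp add: distrib_left bivariate.add)
  qed
next
  case (add f g)
  then show ?case by (simp add: distrib_right bivariate.add)
qed

lemma bivariate_power:
  assumes S: "is_subring S" and "bivariate S \<alpha> f"
  shows "bivariate S \<alpha> (\<lambda>i j. f i j ^ m)"
proof (induction m)
  case 0
  show ?case using bivariate.monomial[OF is_subringD(2)[OF S], of \<alpha> 0 0] by simp
next
  case (Suc m)
  then show ?case using bivariate_mult[OF S assms(2)] by simp
qed

lemma bivariate_sums:
  assumes S: "is_subring S" and p: "\<And>m. (\<Sum>i\<in>I. \<alpha> i ^ m) \<in> S"
  shows "bivariate S \<alpha> f \<Longrightarrow> (\<Sum>i\<in>I. \<Sum>j\<in>I. f i j) \<in> S \<and> (\<Sum>i\<in>I. f i i) \<in> S"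
proof (induction rule: bivariate.induct)
  case (monomial c a b)
  have "(\<Sum>i\<in>I. \<Sum>j\<in>I. c * \<alpha> i ^ a * \<alpha> j ^ b) = c * (\<Sum>i\<in>I. \<alpha> i ^ a) * (\<Sum>j\<in>I. \<alpha> j ^ b)"
    by (simp add: sum_distrib_left sum_distrib_right mult_ac)
  moreover have "(\<Sum>i\<in>I. c * \<alpha> i ^ a * \<alpha> i ^ b) = c * (\<Sum>i\<in>I. \<alpha> i ^ (a + b))"
    by (simp add: sum_distrib_left power_add mult_ac)
  ultimately show ?case using is_subringD[OF S] p monomial by simp
next
  case (add f g)
  then show ?case using is_subringD[OF S] by (simp add: sum.distrib)
qed

text \<open>
  The sum of a symmetric function over pairs \<open>i < j\<close> is half the difference of the sum over all pairs and
  the sum over the diagonal, and both of the latter are polynomials in the power sums of the \<open>\<alpha> i\<close>.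
\<close>

lemma pair_resolvent_over_subfield:
  fixes \<alpha> :: "nat \<Rightarrow> 'a::field_char_0"
  assumes S: "is_subfield S" and c: "c \<in> S" and p: "(\<Prod>i<n. [:- \<alpha> i, 1:]) \<in> polys_over S"
  shows "(\<Prod>(i, j)\<in>index_pairs n. [:- (\<alpha> i + \<alpha> j + c * \<alpha> i * \<alpha> j), 1:]) \<in> polys_over S"
proof -
  note R = is_subfield_imp_is_subring[OF S]
  have ps: "(\<Sum>i<n. \<alpha> i ^ m) \<in> S" for m
    using p polys_over_iff_power_sums[OF finite_lessThan S] by blast
  define f where "f i j = \<alpha> i + \<alpha> j + c * \<alpha> i * \<alpha> j" for i j
  have "bivariate S \<alpha> (\<lambda>i j. (1 * \<alpha> i ^ 1 * \<alpha> j ^ 0 + 1 * \<alpha> i ^ 0 * \<alpha> j ^ 1) + c * \<alpha> i ^ 1 * \<alpha> j ^ 1)"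
    by (intro bivariate.intros c is_subringD[OF R])
  then have f: "bivariate S \<alpha> f" by (simp add: f_def[abs_def])
  have "(\<Sum>x\<in>index_pairs n. (case x of (i, j) \<Rightarrow> f i j) ^ m) \<in> S" for m
  proof -
    have "(\<Sum>i<n. \<Sum>j<n. f i j ^ m) \<in> S" "(\<Sum>i<n. f i i ^ m) \<in> S"
      using bivariate_sums[OF R ps bivariate_power[OF R f, of m]] by auto
    moreover have "(\<Sum>x\<in>index_pairs n. (case x of (i, j) \<Rightarrow> f i j) ^ m) =
        ((\<Sum>i<n. \<Sum>j<n. f i j ^ m) - (\<Sum>i<n. f i i ^ m)) / of_nat 2"
      by (subst sum_symmetric_function) (auto simp: f_def add_ac mult_ac case_prod_beta)
    ultimately show ?thesis
      using subring_of_nat[OF R, of 2]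
      by (simp only:) (intro subfield_divide[OF S] is_subringD(6)[OF R])
  qed
  then have "(\<Prod>x\<in>index_pairs n. [:- (case x of (i, j) \<Rightarrow> f i j), 1:]) \<in> polys_over S"
    using polys_over_iff_power_sums[OF finite_index_pairs S] by blast
  then show ?thesis by (simp add: f_def case_prod_beta)
qed

text \<open>
  The formula for the solutions of a quadratic equation.
\<close>

lemma in_subfield_if_sum_and_product:
  fixes a b :: "'a::field_char_0"
  assumes C: "is_subfield C" and sqrt: "\<And>z. z \<in> C \<Longrightarrow> \<exists>w\<in>C. w ^ 2 = z"
    and "a + b \<in> C" "a * b \<in> C"
  shows "a \<in> C"
proof -
  note R = is_subfield_imp_is_subring[OF C]
  have "(a + b)\<^sup>2 - of_nat 4 * (a * b) \<in> C"
    by (intro is_subringD(6)[OF R subring_power[OF R] is_subringD(4)[OF R subring_of_nat[OF R]]] assms(3,4))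
  then obtain w where w: "w \<in> C" "w\<^sup>2 = (a + b)\<^sup>2 - of_nat 4 * (a * b)" using sqrt by blast
  have "w\<^sup>2 = (a - b)\<^sup>2" unfolding w(2) by (simp add: power2_eq_square algebra_simps)
  then have "a - b = w \<or> a - b = - w" unfolding power2_eq_iff by auto
  then have "a - b \<in> C" using w(1) is_subringD[OF R] by auto
  then have "((a + b) + (a - b)) / of_nat 2 \<in> C"
    using assms(3) by (intro subfield_divide[OF C is_subringD(3)[OF R] subring_of_nat[OF R]])
  then show ?thesis by simp
qed

text \<open>
  Laplace's argument, by induction on the exponent \<open>k\<close> of 2 in the degree \<open>n\<close> of \<open>p\<close>. If \<open>n\<close> is even and
  \<open>\<alpha> i\<close> are the roots of \<open>p\<close> in the algebraically closed field, the resolvent with the roots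
  \<open>\<alpha> i + \<alpha> j + c * \<alpha> i * \<alpha> j\<close> for \<open>i < j\<close> has degree \<open>n * (n - 1) / 2\<close>, which contains one factor 2 less. So
  for every \<open>c\<close> one of these expressions lies in \<open>C\<close>. Two values of \<open>c\<close> share the same pair \<open>i, j\<close>, hence
  the sum and the product of \<open>\<alpha> i\<close> and \<open>\<alpha> j\<close> lie in \<open>C\<close>, and so does \<open>\<alpha> i\<close>.
\<close>

lemma laplace_root:
  fixes S C :: "'a::{field_char_0, alg_closed_field} set"
  assumes S: "is_subfield S" and C: "is_subfield C" and "S \<subseteq> C"
    and odd: "\<And>p. p \<in> polys_over S \<Longrightarrow> odd (degree p) \<Longrightarrow> \<exists>x\<in>C. poly p x = 0"
    and sqrt: "\<And>z. z \<in> C \<Longrightarrow> \<exists>w\<in>C. w ^ 2 = z"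
    and p: "p \<in> polys_over S" "degree p > 0"
  shows "\<exists>x\<in>C. poly p x = 0"
proof -
  note RS = is_subfield_imp_is_subring[OF S]
  note R = is_subfield_imp_is_subring[OF C]
  have "\<exists>x\<in>C. poly p x = 0" if "p \<in> polys_over S" "degree p = 2 ^ k * m" "odd m" for k m p
    using that
  proof (induction k arbitrary: m p)
    case 0
    then show ?case using odd by auto
  next
    case (Suc k)
    define n where "n = degree p"
    have "n > 0" using Suc.prems unfolding n_def by (auto intro: Nat.gr0I)
    then have "p \<noteq> 0" unfolding n_def by auto
    obtain A where A: "size A = n" "p = smult (lead_coeff p) (\<Prod>x\<in>#A. [:-x, 1:])"
      using alg_closed_imp_factorization[OF \<open>p \<noteq> 0\<close>] unfolding n_def by blast
    obtain xs where xs: "mset xs = A" using ex_mset by blast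
    define \<alpha> where "\<alpha> i = xs ! i" for i
    have len: "length xs = n" using A(1) xs by auto
    have "(\<Prod>x\<in>#A. [:-x, 1:]) = prod_list (map (\<lambda>x. [:-x, 1:]) xs)"
      unfolding xs[symmetric] by (simp flip: mset_map prod_mset_prod_list)
    also have "\<dots> = (\<Prod>i<n. [:- \<alpha> i, 1:])"
      unfolding prod.list_conv_set_nth by (simp add: len \<alpha>_def atLeast0LessThan)
    finally have P: "p = smult (lead_coeff p) (\<Prod>i<n. [:- \<alpha> i, 1:])" using A(2) by simp
    have "(\<Prod>i<n. [:- \<alpha> i, 1:]) = smult (1 / lead_coeff p) (smult (lead_coeff p) (\<Prod>i<n. [:- \<alpha> i, 1:]))"
      using \<open>p \<noteq> 0\<close> by simp
    also have "\<dots> = smult (1 / lead_coeff p) p"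
      by (simp only: P[symmetric])
    also have "\<dots> \<in> polys_over S"
      using Suc.prems(1) is_subringD(2)[OF RS] 
      by (intro smult_in_polys_over[OF RS] subfield_divide[OF S]) (auto simp: polys_over_coeff)
    finally have over: "(\<Prod>i<n. [:- \<alpha> i, 1:]) \<in> polys_over S" .
    have n: "n = 2 ^ Suc k * m" using Suc.prems n_def by simp
    have "2 * card (index_pairs n) = n * n - n" using card_index_pairs[of n] by simp
    also have "\<dots> = 2 * (2 ^ k * (m * (n - 1)))"
      by (subst (1 3) n) (simp add: algebra_simps)
    finally have card: "card (index_pairs n) = 2 ^ k * (m * (n - 1))" by simp
    have "even n" unfolding n by simp
    then have "odd (m * (n - 1))" using \<open>n > 0\<close> \<open>odd m\<close> by auto
    have "\<exists>x\<in>index_pairs n. \<alpha> (fst x) + \<alpha> (snd x) + of_nat c * \<alpha> (fst x) * \<alpha> (snd x) \<in> C" for c :: nat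
    proof -
      let ?q = "\<Prod>(i, j)\<in>index_pairs n. [:- (\<alpha> i + \<alpha> j + of_nat c * \<alpha> i * \<alpha> j), 1:]"
      have "?q \<in> polys_over S" 
        using subring_of_nat[OF RS] by (rule pair_resolvent_over_subfield[OF S _ over])
      moreover have "degree ?q = 2 ^ k * (m * (n - 1))"
        unfolding case_prod_beta card[symmetric] by (subst degree_prod_eq_sum_degree) auto
      ultimately obtain x where "x \<in> C" "poly ?q x = 0"
        using Suc.IH[OF _ _ \<open>odd (m * (n - 1))\<close>] by blast
      then obtain y where y: "y \<in> index_pairs n"
          "poly (case y of (i, j) \<Rightarrow> [:- (\<alpha> i + \<alpha> j + of_nat c * \<alpha> i * \<alpha> j), 1:]) x = 0"
        unfolding poly_prod prod_zero_iff[OF finite_index_pairs] by blast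
      then have "x = \<alpha> (fst y) + \<alpha> (snd y) + of_nat c * \<alpha> (fst y) * \<alpha> (snd y)"
        by (simp add: case_prod_beta algebra_simps add_eq_0_iff)
      then show ?thesis using \<open>x \<in> C\<close> y(1) by blast
    qed
    then obtain g where g: "\<And>c::nat. g c \<in> index_pairs n"
        "\<And>c. \<alpha> (fst (g c)) + \<alpha> (snd (g c)) + of_nat c * \<alpha> (fst (g c)) * \<alpha> (snd (g c)) \<in> C"
      by metis
    \<comment> \<open>Infinitely many \<open>c\<close>, finitely many pairs.\<close>
    have "\<not> inj g"
      using g(1) finite_index_pairs[of n] by (metis finite_imageD finite_subset image_subsetI infinite_UNIV_nat)
    then obtain c d where cd: "c \<noteq> d" "g c = g d" by (auto simp: inj_on_def)
    define a b where "a = \<alpha> (fst (g c))" and "b = \<alpha> (snd (g c))"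
    have ac: "a + b + of_nat c * a * b \<in> C" and ad: "a + b + of_nat d * a * b \<in> C"
      using g(2)[of c] g(2)[of d] cd by (auto simp: a_def b_def)
    have "(a + b + of_nat c * a * b) - (a + b + of_nat d * a * b) = (of_nat c - of_nat d) * (a * b)"
      by (simp add: algebra_simps)
    then have "(of_nat c - of_nat d) * (a * b) \<in> C" using is_subringD(6)[OF R ac ad] by simp
    then have "(of_nat c - of_nat d) * (a * b) / (of_nat c - of_nat d) \<in> C"
      by (rule subfield_divide[OF C _ is_subringD(6)[OF R subring_of_nat[OF R] subring_of_nat[OF R]]])
    then have ab: "a * b \<in> C" using cd(1) by simp
    have "(a + b + of_nat c * a * b) - of_nat c * (a * b) \<in> C"
      by (rule is_subringD(6)[OF R ac is_subringD(4)[OF R subring_of_nat[OF R] ab]])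
    then have "a + b \<in> C" by (simp add: mult.assoc)
    then have "a \<in> C" using in_subfield_if_sum_and_product[OF C sqrt _ ab] by blast
    moreover have "poly p a = 0"
      using g(1)[of c] unfolding index_pairs_def a_def
      by (subst P) (auto simp: poly_prod case_prod_beta intro!: bexI[of _ "fst (g c)"])
    ultimately show ?case by blast
  qed
  moreover obtain k m where "degree p = 2 ^ k * m" "odd m"
  proof -
    have "\<exists>k m. d = 2 ^ k * m \<and> odd m" if "d > 0" for d :: nat
      using that
    proof (induction d rule: less_induct)
      case (less d)
      show ?case
      proof (cases "odd d")
        case True
        then show ?thesis by (intro exI[of _ 0] exI[of _ d]) simp
      next
        case False
        then obtain e where e: "d = 2 * e" by blast
        then obtain k m where "e = 2 ^ k * m" "odd m"
          using less.IH[of e] less.prems by auto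
        then show ?thesis using e by (intro exI[of _ "Suc k"] exI[of _ m]) simp
      qed
    qed
    then show ?thesis using that p by blast
  qed
  ultimately show ?thesis using p by blast
qed

section \<open>Polynomials over a real closed field\<close>

lemma sum_squares_eq_0_iff: "(u::'a::linordered_field)\<^sup>2 + v\<^sup>2 = 0 \<longleftrightarrow> u = 0 \<and> v = 0"
  by (simp add: sum_power2_eq_zero_iff)

text \<open>
  The element \<open>u + \<iota> v\<close> of \<open>F(\<iota>)\<close>, to be used for a square root \<open>\<iota>\<close> of \<open>-1\<close>.
\<close>

definition gauss :: "'a::field alg_closure \<Rightarrow> 'a \<Rightarrow> 'a \<Rightarrow> 'a alg_closure" where
  "gauss \<iota> u v = to_ac u + \<iota> * to_ac v"

context
  assumes real_closed: "real_closed TYPE('a::linordered_field)"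
begin

lemma real_closed_sqrt: "0 \<le> (x::'a) \<Longrightarrow> \<exists>y\<ge>0. y\<^sup>2 = x"
proof -
  assume "0 \<le> x"
  then obtain y where "y\<^sup>2 = x" using real_closed by (auto simp: real_closed_def)
  then show ?thesis by (intro exI[of _ "\<bar>y\<bar>"]) auto
qed

lemma real_closed_odd_root: "odd (degree (p :: 'a poly)) \<Longrightarrow> \<exists>x. poly p x = 0"
  using real_closed by (auto simp: real_closed_def)

text \<open>
  \<open>F(\<iota>)\<close> is a subfield of the algebraic closure in which every element has a square root: for \<open>u + \<iota> v\<close> with
  \<open>v \<noteq> 0\<close> it is \<open>x + \<iota> v / (2 x)\<close> where \<open>x\<^sup>2 = (r + u) / 2\<close> and \<open>r\<close> is the absolute value. So Laplace's
  argument applies.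
\<close>

lemma root_in_gauss:
  fixes p :: "'a poly"
  assumes i: "\<iota>\<^sup>2 = -1" and p: "degree p > 0"
  shows "\<exists>u v. poly (map_poly to_ac p) (gauss \<iota> u v) = 0"
proof -
  define C where "C = {gauss \<iota> u v | u v. True}"
  have ii: "\<iota> * \<iota> = -1" using i by (simp add: power2_eq_square)
  have add: "gauss \<iota> u v + gauss \<iota> x y = gauss \<iota> (u + x) (v + y)" for u v x y
    by (simp add: gauss_def algebra_simps)
  have mult: "gauss \<iota> u v * gauss \<iota> x y = gauss \<iota> (u * x - v * y) (u * y + v * x)" for u v x y
  proof -
    have "gauss \<iota> u v * gauss \<iota> x y = to_ac u * to_ac x + (\<iota> * \<iota>) * (to_ac v * to_ac y) + \<iota> * (to_ac u * to_ac y + to_ac v * to_ac x)"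
      by (simp add: gauss_def algebra_simps)
    then show ?thesis unfolding ii by (simp add: gauss_def)
  qed
  have minus: "- gauss \<iota> u v = gauss \<iota> (-u) (-v)" for u v
    by (simp add: gauss_def)
  have inv: "\<exists>x y. inverse (gauss \<iota> u v) = gauss \<iota> x y" for u v
  proof (cases "u = 0 \<and> v = 0")
    case True
    then have "inverse (gauss \<iota> u v) = gauss \<iota> 0 0" by (simp add: gauss_def)
    then show ?thesis by blast
  next
    case False
    then have nz: "u\<^sup>2 + v\<^sup>2 \<noteq> 0" using sum_squares_eq_0_iff by blast
    define N where "N = u\<^sup>2 + v\<^sup>2"
    have "u * (u / N) - v * (- v / N) = (u\<^sup>2 + v\<^sup>2) / N"
      by (simp add: power2_eq_square add_divide_distrib)
    then have "gauss \<iota> u v * gauss \<iota> (u / N) (- v / N) = 1"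
      unfolding mult using nz by (simp add: gauss_def N_def[symmetric])
    then show ?thesis using inverse_unique by blast
  qed
  have C: "is_subfield C"
    unfolding is_subfield_def
  proof (intro conjI ballI)
    have "gauss \<iota> 0 0 = 0" "gauss \<iota> 1 0 = 1" by (simp_all add: gauss_def)
    then show "0 \<in> C" "1 \<in> C" unfolding C_def by (metis (mono_tags, lifting) mem_Collect_eq)+
  next
    fix x y assume "x \<in> C" "y \<in> C"
    then show "x + y \<in> C" "x * y \<in> C" unfolding C_def using add mult by fastforce+
  next
    fix x assume "x \<in> C"
    then show "- x \<in> C" "inverse x \<in> C" unfolding C_def using minus inv by fastforce+
  qed
  have S: "is_subfield (range (to_ac :: 'a \<Rightarrow> _))"
    unfolding is_subfield_def
    by (auto simp flip: to_ac_add to_ac_mult to_ac_minus to_ac_inverse to_ac_0 to_ac_1)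
  have "to_ac x = gauss \<iota> x 0" for x by (simp add: gauss_def)
  then have SC: "range to_ac \<subseteq> C" unfolding C_def by blast
  have sqrt: "\<exists>w\<in>C. w\<^sup>2 = z" if "z \<in> C" for z
  proof -
    from that obtain u v where z: "z = gauss \<iota> u v" unfolding C_def by blast
    have "\<exists>x y. x\<^sup>2 - y\<^sup>2 = u \<and> 2 * x * y = v"
    proof (cases "v = 0")
      case True
      show ?thesis
      proof (cases "u \<ge> 0")
        case ge: True
        then obtain x where "x\<^sup>2 = u" using real_closed_sqrt by blast
        then show ?thesis using True by (intro exI[of _ x] exI[of _ 0]) simp
      next
        case False
        then obtain y where "y\<^sup>2 = - u" using real_closed_sqrt[of "- u"] by auto
        then show ?thesis using True by (intro exI[of _ 0] exI[of _ y]) simp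
      qed
    next
      case False
      obtain r where r: "r \<ge> 0" "r\<^sup>2 = u\<^sup>2 + v\<^sup>2" using real_closed_sqrt[of "u\<^sup>2 + v\<^sup>2"] by auto
      have "\<bar>u\<bar> < r" 
        by (rule power2_less_imp_less) (use r False in auto)
      then have ru: "r + u > 0" by linarith
      then obtain x where x: "x\<^sup>2 = (r + u) / 2" using real_closed_sqrt[of "(r + u) / 2"] by auto
      then have "x \<noteq> 0" using ru by auto
      have "(v / (2 * x))\<^sup>2 = v\<^sup>2 / (4 * x\<^sup>2)" by (simp add: power_divide power_mult_distrib)
      also have "4 * x\<^sup>2 = 2 * (r + u)" unfolding x by simp
      also have "v\<^sup>2 = (r - u) * (r + u)" using r(2) by (simp add: algebra_simps power2_eq_square)
      also have "(r - u) * (r + u) / (2 * (r + u)) = (r - u) / 2"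
        by (rule mult_divide_mult_cancel_right) (use ru in simp)
      finally have "x\<^sup>2 - (v / (2 * x))\<^sup>2 = u" unfolding x by (simp add: field_simps)
      moreover have "2 * x * (v / (2 * x)) = v" using \<open>x \<noteq> 0\<close> by simp
      ultimately show ?thesis by blast
    qed
    then obtain x y where xy: "x\<^sup>2 - y\<^sup>2 = u" "2 * x * y = v" by blast
    have "(gauss \<iota> x y)\<^sup>2 = z"
      unfolding power2_eq_square mult z xy[symmetric] by (simp add: algebra_simps)
    then show ?thesis unfolding C_def by blast
  qed
  have hom: "poly (map_poly to_ac q) (to_ac x) = to_ac (poly q x)" for q :: "'a poly" and x
    by (rule poly_map_poly_hom) auto
  have "\<exists>x\<in>C. poly q x = 0" if "q \<in> polys_over (range (to_ac :: 'a \<Rightarrow> _))" "odd (degree q)" for q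
  proof -
    note odd = that(2)
    have q: "q = map_poly to_ac (map_poly of_ac q)"
      using that(1) by (intro poly_eqI) (simp add: coeff_map_poly polys_over_def to_ac_of_ac)
    then have "degree q = degree (map_poly of_ac q :: 'a poly)"
      by (metis degree_map_poly to_ac_eq_0_iff)
    then obtain x :: 'a where "poly (map_poly of_ac q) x = 0"
      using real_closed_odd_root[of "map_poly of_ac q"] odd by auto
    then have "poly q (to_ac x) = 0" by (subst q) (simp add: hom)
    then show ?thesis using SC by blast
  qed
  then have "\<exists>x\<in>C. poly (map_poly to_ac p) x = 0"
    using laplace_root[OF S C SC _ sqrt, of "map_poly to_ac p"] p
    by (auto simp: polys_over_def coeff_map_poly degree_map_poly)
  then show ?thesis unfolding C_def by blast
qed

text \<open>
  A polynomial without roots in \<open>F\<close> vanishes at some \<open>u + \<iota> v\<close> with \<open>v \<noteq> 0\<close>, and the remainder of its division by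
  the minimal polynomial of \<open>u + \<iota> v\<close> has degree at most one and vanishes there too, so it is zero.
\<close>

lemma quadratic_factor:
  fixes p :: "'a poly"
  assumes p: "degree p > 0" and no_root: "\<And>x. poly p x \<noteq> 0"
  shows "\<exists>u v q. v \<noteq> 0 \<and> p = [:u\<^sup>2 + v\<^sup>2, - 2 * u, 1:] * q"
proof -
  obtain \<iota> :: "'a alg_closure" where i: "\<iota>\<^sup>2 = -1" using nth_root_exists[of 2 "-1"] by auto
  then have ii: "\<iota> * \<iota> = -1" by (simp add: power2_eq_square)
  obtain u v where root: "poly (map_poly to_ac p) (gauss \<iota> u v) = 0"
    using root_in_gauss[OF i p] by blast
  have hom: "poly (map_poly to_ac q) (to_ac x) = to_ac (poly q x)" for q :: "'a poly" and x
    by (rule poly_map_poly_hom) auto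
  have "v \<noteq> 0"
  proof
    assume "v = 0"
    then have "to_ac (poly p u) = 0" using root by (simp add: gauss_def hom)
    then show False using no_root by simp
  qed
  define d where "d = [:u\<^sup>2 + v\<^sup>2, - 2 * u, 1:]"
  have "degree d = 2" "d \<noteq> 0" by (simp_all add: d_def)
  then have "degree (p mod d) < 2" using degree_mod_less'[of d p] by (cases "p mod d = 0") auto
  then have "p mod d = [:coeff (p mod d) 0, coeff (p mod d) 1:]"
    by (intro poly_eqI) (auto simp: coeff_pCons coeff_eq_0 split: nat.split)
  then obtain a b where ab: "p mod d = [:a, b:]" by blast
  have "poly (map_poly to_ac d) (gauss \<iota> u v) = (\<iota> * \<iota> + 1) * to_ac (v\<^sup>2)"
    by (simp add: d_def gauss_def map_poly_pCons algebra_simps power2_eq_square)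
  then have d0: "poly (map_poly to_ac d) (gauss \<iota> u v) = 0" by (simp add: ii)
  have "map_poly to_ac p = map_poly to_ac (d * (p div d)) + map_poly to_ac (p mod d)"
    by (subst map_poly_hom_add[symmetric]) auto
  also have "map_poly to_ac (d * (p div d)) = map_poly to_ac d * map_poly to_ac (p div d)"
    by (rule map_poly_hom_mult) auto
  finally have "poly (map_poly to_ac (p mod d)) (gauss \<iota> u v) = 0"
    using root d0 by simp
  then have "to_ac (a + u * b) + \<iota> * to_ac (v * b) = 0"
    unfolding ab by (simp add: gauss_def map_poly_pCons algebra_simps)
  then have "to_ac (a + u * b) = - (\<iota> * to_ac (v * b))"
    by (simp only: eq_neg_iff_add_eq_0)
  then have "(to_ac (a + u * b))\<^sup>2 = (\<iota> * \<iota>) * (to_ac (v * b))\<^sup>2"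
    by (simp add: power2_eq_square algebra_simps)
  then have "to_ac ((a + u * b)\<^sup>2 + (v * b)\<^sup>2) = 0" by (simp add: ii)
  then have "a + u * b = 0 \<and> v * b = 0" by (simp only: to_ac_eq_0_iff sum_squares_eq_0_iff)
  then have "p mod d = 0" unfolding ab using \<open>v \<noteq> 0\<close> by auto
  then have "p = d * (p div d)" by (metis add_0_right mult_div_mod_eq)
  then show ?thesis unfolding d_def using \<open>v \<noteq> 0\<close> by blast
qed

text \<open>
  Such a polynomial is a constant times a product of polynomials \<open>(X - u)\<^sup>2 + v\<^sup>2\<close>, which are positive.
\<close>

lemma constant_sign_if_no_root:
  fixes p :: "'a poly"
  assumes "\<And>x. poly p x \<noteq> 0"
  shows "poly p x > 0 \<longleftrightarrow> poly p y > 0"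
  using assms
proof (induction "degree p" arbitrary: p rule: less_induct)
  case less
  show ?case
  proof (cases "degree p = 0")
    case True
    then show ?thesis by (metis degree_eq_zeroE poly_pCons mult_zero_right poly_0)
  next
    case False
    then obtain u v q where v: "v \<noteq> 0" and p: "p = [:u\<^sup>2 + v\<^sup>2, - 2 * u, 1:] * q"
      using quadratic_factor less.prems by blast
    have val: "poly p z = ((z - u)\<^sup>2 + v\<^sup>2) * poly q z" for z
      unfolding p by (simp add: power2_eq_square algebra_simps)
    have pos: "(z - u)\<^sup>2 + v\<^sup>2 > 0" for z using v by (simp add: sum_power2_gt_zero_iff)
    have q: "poly q z \<noteq> 0" for z using less.prems[of z] val by auto
    then have "q \<noteq> 0" by auto
    then have "degree q < degree p" unfolding p by (subst degree_mult_eq) auto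
    then have "poly q x > 0 \<longleftrightarrow> poly q y > 0" using less.hyps q by blast
    then show ?thesis unfolding val using pos by (metis mult_pos_pos zero_less_mult_pos)
  qed
qed

text \<open>
  Split off the roots outside the interval one by one; this does not affect the change of sign. If no
  root remains, the sign is constant.
\<close>

lemma poly_IVT_real_closed:
  fixes p :: "'a poly"
  assumes "a < b" and "poly p a * poly p b < 0"
  shows "\<exists>c. a < c \<and> c < b \<and> poly p c = 0"
  using assms(2)
proof (induction "degree p" arbitrary: p rule: less_induct)
  case less
  show ?case
  proof (rule ccontr)
    assume no: "\<not> ?thesis"
    have "\<exists>r. poly p r = 0"
    proof (rule ccontr)
      assume "\<not> ?thesis"
      then show False using constant_sign_if_no_root[of p a b] less.prems
        by (auto simp: mult_less_0_iff)
    qed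
    then obtain r where r: "poly p r = 0" by blast
    then obtain q where q: "p = [:- r, 1:] * q" by (metis dvdE poly_eq_0_iff_dvd)
    have val: "poly p z = (z - r) * poly q z" for z unfolding q by (simp add: algebra_simps)
    have "q \<noteq> 0" using less.prems q by auto
    then have deg: "degree q < degree p" unfolding q by (subst degree_mult_eq) auto
    have "r < a \<or> r > b" using no r less.prems by (metis linorder_neqE_linordered_idom mult_zero_left mult_zero_right order_less_irrefl)
    then have "(a - r) * (b - r) > 0" using assms(1) by (auto simp: zero_less_mult_iff)
    moreover have "((a - r) * (b - r)) * (poly q a * poly q b) < 0"
      using less.prems unfolding val by (simp add: mult_ac)
    ultimately have "poly q a * poly q b < 0" by (meson mult_less_0_iff order_less_asym)
    then obtain c where "a < c" "c < b" "poly q c = 0" using less.hyps[OF deg] by blast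
    then show False using no val by auto
  qed
qed

text \<open>
  With \<open>p = (X - a)^k (X - b)^l q\<close> the derivative is \<open>(X - a)^(k-1) (X - b)^(l-1) h\<close>, and \<open>h\<close> takes values of
  opposite signs at \<open>a\<close> and \<open>b\<close>, because \<open>q\<close> has the same sign at both points.
\<close>

lemma poly_Rolle_consecutive:
  fixes p :: "'a poly"
  assumes "a < b" "poly p a = 0" "poly p b = 0" and no_root: "\<And>c. a < c \<Longrightarrow> c < b \<Longrightarrow> poly p c \<noteq> 0"
  shows "\<exists>c. a < c \<and> c < b \<and> poly (pderiv p) c = 0"
proof -
  have "p \<noteq> 0" using no_root[of "(a + b) / 2"] assms(1) by auto
  define k where "k = order a p"
  obtain p1 where p1: "p = [:- a, 1:] ^ k * p1" "poly p1 a \<noteq> 0"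
    using order_decomp[OF \<open>p \<noteq> 0\<close>, of a] unfolding k_def poly_eq_0_iff_dvd by blast
  then have "p1 \<noteq> 0" by auto
  define l where "l = order b p1"
  obtain q where q: "p1 = [:- b, 1:] ^ l * q" "poly q b \<noteq> 0"
    using order_decomp[OF \<open>p1 \<noteq> 0\<close>, of b] unfolding l_def poly_eq_0_iff_dvd by blast
  have "k \<noteq> 0" using p1 assms(2) by (auto intro: ccontr)
  have "poly p1 b = 0" using assms(1,3) p1(1) by simp
  then have "l \<noteq> 0" using q by (auto intro: ccontr)
  obtain k' where k': "k = Suc k'" using \<open>k \<noteq> 0\<close> not0_implies_Suc by blast
  obtain l' where l': "l = Suc l'" using \<open>l \<noteq> 0\<close> not0_implies_Suc by blast
  have qa: "poly q a \<noteq> 0" using p1(2) q by auto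
  have val: "poly p z = (z - a) ^ k * (z - b) ^ l * poly q z" for z
    unfolding p1(1) q(1) by (simp add: algebra_simps)
  have "poly q a * poly q b > 0"
  proof (rule ccontr)
    assume "\<not> ?thesis"
    then have "poly q a * poly q b < 0" using qa q(2) by (metis linorder_neqE_linordered_idom mult_eq_0_iff)
    then obtain c where "a < c" "c < b" "poly q c = 0" using poly_IVT_real_closed[OF assms(1)] by blast
    then show False using no_root[of c] val by simp
  qed
  define h where "h = smult (of_nat k) ([:- b, 1:] * q) + smult (of_nat l) ([:- a, 1:] * q) + [:- a, 1:] * [:- b, 1:] * pderiv q"
  have p: "p = [:- a, 1:] ^ Suc k' * ([:- b, 1:] ^ Suc l' * q)" using p1 q k' l' by simp
  have "pderiv p = [:- a, 1:] ^ k' * [:- b, 1:] ^ l' * h"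
    unfolding p pderiv_mult pderiv_power_Suc h_def k' l'
    by (subst poly_eq_poly_eq_iff[symmetric]) (simp add: fun_eq_iff pderiv_pCons algebra_simps)
  moreover have "\<exists>c. a < c \<and> c < b \<and> poly h c = 0"
  proof (rule poly_IVT_real_closed[OF assms(1)])
    have "poly h a * poly h b = - (of_nat k * of_nat l * (b - a)\<^sup>2) * (poly q a * poly q b)"
      unfolding h_def by (simp add: power2_eq_square algebra_simps)
    moreover have "of_nat k * of_nat l * (b - a)\<^sup>2 > 0"
      using assms(1) \<open>k \<noteq> 0\<close> \<open>l \<noteq> 0\<close> by simp
    ultimately show "poly h a * poly h b < 0" using \<open>poly q a * poly q b > 0\<close>
      by (simp add: mult_neg_pos)
  qed
  ultimately show ?thesis by auto
qed

lemma poly_Rolle_real_closed: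
  fixes p :: "'a poly"
  assumes "a < b" "poly p a = 0" "poly p b = 0"
  shows "\<exists>c. a < c \<and> c < b \<and> poly (pderiv p) c = 0"
proof (cases "p = 0")
  case True
  then show ?thesis using dense[OF assms(1)] by auto
next
  case False
  define R where "R = {c. a < c \<and> c \<le> b \<and> poly p c = 0}"
  have fin: "finite R" using poly_roots_finite[OF False] by (rule finite_subset[rotated]) (auto simp: R_def)
  have "b \<in> R" using assms by (simp add: R_def)
  then have m: "Min R \<in> R" "\<And>c. c \<in> R \<Longrightarrow> Min R \<le> c"
    using Min_in[OF fin] Min_le[OF fin] by blast+
  have "\<exists>c. a < c \<and> c < Min R \<and> poly (pderiv p) c = 0"
  proof (rule poly_Rolle_consecutive)
    show "poly p c \<noteq> 0" if "a < c" "c < Min R" for c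
      using m(2)[of c] m(1) that unfolding R_def by auto
  qed (use m(1) assms in \<open>auto simp: R_def\<close>)
  then show ?thesis using m(1) unfolding R_def by auto
qed

lemma poly_MVT_real_closed:
  fixes p :: "'a poly"
  assumes "a < b"
  shows "\<exists>c. a < c \<and> c < b \<and> poly p b - poly p a = (b - a) * poly (pderiv p) c"
proof -
  define m where "m = (poly p b - poly p a) / (b - a)"
  have m: "m * (b - a) = poly p b - poly p a" using assms by (simp add: m_def)
  define q where "q = p - [:poly p a - m * a, m:]"
  have "poly q a = 0" by (simp add: q_def)
  moreover have "poly q b = 0" using m by (simp add: q_def algebra_simps)
  ultimately obtain c where "a < c" "c < b" "poly (pderiv q) c = 0"
    using poly_Rolle_real_closed[OF assms] by blast
  moreover have "poly (pderiv q) c = poly (pderiv p) c - m"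
    by (simp add: q_def pderiv_diff pderiv_pCons)
  ultimately show ?thesis using m by (metis eq_iff_diff_eq_0 mult.commute)
qed

text \<open>
  The sign of the derivative is constant on the interval by the intermediate value theorem, so it may be
  tested at any point \<open>z\<close>; the mean value theorem then gives monotonicity on the closed interval.
\<close>

lemma poly_strictly_monotone_if_no_critical_point:
  fixes p :: "'a poly"
  assumes no: "\<And>z. c < z \<Longrightarrow> z < d \<Longrightarrow> poly (pderiv p) z \<noteq> 0" and z: "c < z" "z < d"
    and uv: "c \<le> u" "u < v" "v \<le> d"
  shows "poly (pderiv p) z > 0 \<longleftrightarrow> poly p u < poly p v"
proof -
  obtain w where w: "u < w" "w < v" "poly p v - poly p u = (v - u) * poly (pderiv p) w"
    using poly_MVT_real_closed[OF uv(2)] by blast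
  have wz: "poly (pderiv p) w \<noteq> 0" "poly (pderiv p) z \<noteq> 0" using no[of w] no[of z] z w uv by auto
  have "\<not> poly (pderiv p) w * poly (pderiv p) z < 0"
  proof
    assume neg: "poly (pderiv p) w * poly (pderiv p) z < 0"
    have "w \<noteq> z" using neg by (auto simp: mult_less_0_iff)
    then consider "w < z" | "z < w" by fastforce
    then show False
    proof cases
      case 1
      then show False using poly_IVT_real_closed[OF 1 neg] no w uv z by (meson less_trans less_le_trans le_less_trans)
    next
      case 2
      then show False using poly_IVT_real_closed[OF 2, of "pderiv p"] neg no w uv z
        by (metis mult.commute less_trans less_le_trans le_less_trans)
    qed
  qed
  then have "poly (pderiv p) z > 0 \<longleftrightarrow> poly (pderiv p) w > 0"
    using wz by (metis linorder_neqE_linordered_idom mult_neg_pos mult_pos_neg)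
  also have "\<dots> \<longleftrightarrow> poly p v - poly p u > 0" unfolding w(3) using uv(2) by (simp add: zero_less_mult_iff)
  finally show ?thesis by simp
qed

end


section \<open>Relatively algebraically closed subfields\<close>

text \<open>
  The subfields that are relatively algebraically closed in the ambient field.
\<close>

definition rac :: "'a::field set \<Rightarrow> bool" where
  "rac K \<longleftrightarrow> is_subfield K \<and> (\<forall>p\<in>polys_over K. p \<noteq> 0 \<longrightarrow> (\<forall>z. poly p z = 0 \<longrightarrow> z \<in> K))"

definition algebraics :: "'a::field set \<Rightarrow> 'a set" where
  "algebraics K = {z. \<exists>p\<in>polys_over K. p \<noteq> 0 \<and> poly p z = 0}"

lemma rac_is_subfield: "rac K \<Longrightarrow> is_subfield K"
  by (simp add: rac_def)

lemma rac_is_subring: "rac K \<Longrightarrow> is_subring K"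
  by (simp add: rac_def is_subfield_imp_is_subring)

lemma rac_root: "rac K \<Longrightarrow> p \<in> polys_over K \<Longrightarrow> p \<noteq> 0 \<Longrightarrow> poly p z = 0 \<Longrightarrow> z \<in> K"
  by (auto simp: rac_def)

lemma set_coeffs_subset: "p \<in> polys_over S \<Longrightarrow> set (coeffs p) \<subseteq> S"
  by (auto simp: polys_over_def coeffs_def)

lemma rac_Inter:
  assumes "\<And>K. K \<in> \<C> \<Longrightarrow> rac K"
  shows "rac (\<Inter>\<C>)"
  unfolding rac_def
proof safe
  show "is_subfield (\<Inter>\<C>)"
    using assms unfolding rac_def is_subfield_def by blast
next
  fix p z K assume "p \<in> polys_over (\<Inter>\<C>)" "p \<noteq> 0" "poly p z = 0" "K \<in> \<C>"
  moreover have "p \<in> polys_over K" using calculation polys_over_mono[of "\<Inter>\<C>" K] by blast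
  ultimately show "z \<in> K" using assms rac_root by blast
qed

lemma rac_hull: "rac (rac hull X)"
  by (rule hull_in) (auto intro: rac_Inter)


lemma polys_over_Union_chain:
  assumes chain: "\<And>A B. A \<in> \<C> \<Longrightarrow> B \<in> \<C> \<Longrightarrow> A \<subseteq> B \<or> B \<subseteq> A"
    and "\<C> \<noteq> {}" and zero: "\<And>A. A \<in> \<C> \<Longrightarrow> 0 \<in> A"
  shows "p \<in> polys_over (\<Union>\<C>) \<Longrightarrow> \<exists>A\<in>\<C>. p \<in> polys_over A"
proof (induction p)
  case 0
  then show ?case using \<open>\<C> \<noteq> {}\<close> zero by (auto simp: polys_over_def)
next
  case (pCons a p)
  then obtain A B where AB: "A \<in> \<C>" "B \<in> \<C>" "a \<in> A" "p \<in> polys_over B"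
    by (auto simp: pCons_in_polys_over_iff)
  consider "A \<subseteq> B" | "B \<subseteq> A" using chain AB by blast
  then show ?case
  proof cases
    case 1
    then show ?thesis using AB by (intro bexI[of _ B]) (auto simp: pCons_in_polys_over_iff)
  next
    case 2
    then show ?thesis using AB polys_over_mono[OF 2]
      by (intro bexI[of _ A]) (auto simp: pCons_in_polys_over_iff)
  qed
qed

lemma rac_Union_chain:
  assumes chain: "\<And>A B. A \<in> \<C> \<Longrightarrow> B \<in> \<C> \<Longrightarrow> A \<subseteq> B \<or> B \<subseteq> A"
    and "\<C> \<noteq> {}" and rac: "\<And>A. A \<in> \<C> \<Longrightarrow> rac A"
  shows "rac (\<Union>\<C>)"
proof -
  have sub: "is_subfield A" if "A \<in> \<C>" for A using rac that rac_is_subfield by blast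
  have two: "\<exists>A\<in>\<C>. x \<in> A \<and> y \<in> A" if "x \<in> \<Union>\<C>" "y \<in> \<Union>\<C>" for x y
    using that chain by blast
  have "is_subfield (\<Union>\<C>)"
    unfolding is_subfield_def
  proof (intro conjI ballI)
    show "0 \<in> \<Union>\<C>" "1 \<in> \<Union>\<C>"
      using sub \<open>\<C> \<noteq> {}\<close> by (auto simp: is_subfield_def)
  next
    fix x y assume "x \<in> \<Union>\<C>" "y \<in> \<Union>\<C>"
    then show "x + y \<in> \<Union>\<C>" "x * y \<in> \<Union>\<C>"
      using two[of x y] sub by (auto simp: is_subfield_def)
  next
    fix x assume "x \<in> \<Union>\<C>"
    then obtain A where A: "A \<in> \<C>" "x \<in> A" by blast
    then have "- x \<in> A" "inverse x \<in> A" using sub[of A] by (auto simp: is_subfield_def)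
    then show "- x \<in> \<Union>\<C>" "inverse x \<in> \<Union>\<C>" using A(1) by blast+
  qed
  moreover have "z \<in> \<Union>\<C>" if p: "p \<in> polys_over (\<Union>\<C>)" "p \<noteq> 0" "poly p z = 0" for p z
  proof -
    have "\<exists>A\<in>\<C>. p \<in> polys_over A"
      using polys_over_Union_chain[OF chain \<open>\<C> \<noteq> {}\<close> _ p(1)] sub by (auto simp: is_subfield_def)
    then show ?thesis using rac_root[OF rac] p by blast
  qed
  ultimately show ?thesis unfolding rac_def by blast
qed

subsection \<open>Transitivity of algebraic dependence\<close>

text \<open>
  Transitivity of algebraic dependence: if the coefficients of \<open>p\<close> are algebraic over \<open>K\<close>, they generate a
  finite extension \<open>L\<close> of \<open>K\<close>, and adjoining a root of \<open>p\<close> to \<open>L\<close> gives a finite extension of \<open>K\<close> again. The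
  theory of finite extensions is formulated for carrier-based rings, so the field is first regarded as
  one, with coefficient lists in the place of polynomials.
\<close>

lemma rac_algebraics:
  fixes K :: "'a::field set"
  assumes K: "is_subfield K"
  shows "rac (algebraics K)" and "K \<subseteq> algebraics K"
proof -
  define R where "R = (ring_of_type_algebra :: 'a ring)"
  interpret R: field R unfolding R_def by (rule field_from_type_algebra)
  have ops: "carrier R = UNIV" "\<zero>\<^bsub>R\<^esub> = 0" "\<one>\<^bsub>R\<^esub> = 1"
      "\<And>x y. x \<otimes>\<^bsub>R\<^esub> y = x * y" "\<And>x y. x \<oplus>\<^bsub>R\<^esub> y = x + y"
    by (simp_all add: R_def ring_of_type_algebra_def)
  have minus: "\<ominus>\<^bsub>R\<^esub> x = - x" for x
    by (rule R.minus_equality) (simp_all add: ops)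
  have inv: "inv\<^bsub>R\<^esub> x = inverse x" if "x \<noteq> 0" for x
    by (rule R.inv_char) (use that in \<open>simp_all add: ops\<close>)
  have pow: "x [^]\<^bsub>R\<^esub> n = x ^ n" for x and n :: nat
    by (induction n) (simp_all add: ops R.nat_pow_Suc mult.commute)
  have eval: "R.eval p x = poly (Poly (rev p)) x" for p x
    by (induction p) (simp_all add: ops pow Poly_append poly_monom algebra_simps)
  have subfield: "subfield S R \<longleftrightarrow> is_subfield S" for S
  proof
    assume S: "subfield S R"
    note SR = R.subring_props[OF S]
    show "is_subfield S"
      unfolding is_subfield_def
    proof (intro conjI ballI)
      fix x assume "x \<in> S"
      then show "- x \<in> S" using SR(5)[of x] by (simp add: minus)
      show "inverse x \<in> S"
        using R.subfield_m_inv(1)[OF S, of x] \<open>x \<in> S\<close> inv[of x] SR(2)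
        by (cases "x = 0") (auto simp: ops)
    qed (use SR in \<open>auto simp: ops\<close>)
  next
    assume S: "is_subfield S"
    show "subfield S R"
    proof (rule R.subfieldI'[OF R.subringI])
      fix k assume "k \<in> S - {\<zero>\<^bsub>R\<^esub>}"
      then show "inv\<^bsub>R\<^esub> k \<in> S" using S inv[of k] by (auto simp: ops is_subfield_def)
    qed (use S in \<open>auto simp: ops minus is_subfield_def\<close>)
  qed
  have alg: "(R.algebraic over S) x \<longleftrightarrow> x \<in> algebraics S" if S: "is_subfield S" for S x
  proof
    assume "(R.algebraic over S) x"
    then obtain p where p: "p \<in> carrier (S[X]\<^bsub>R\<^esub>)" "p \<noteq> []" "R.eval p x = \<zero>\<^bsub>R\<^esub>"
      using R.algebraicE[of S x] subfieldE(1)[of S R] S subfield ops by auto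
    from p(1,2) have set: "set p \<subseteq> S" "hd p \<noteq> 0"
      by (auto simp: univ_poly_def polynomial_def ops)
    have "coeff (Poly (rev p)) (length p - 1) = hd p"
      using p(2) by (simp add: nth_default_def rev_nth hd_conv_nth)
    then have "Poly (rev p) \<noteq> 0" using set(2) by (metis coeff_0)
    moreover have "Poly (rev p) \<in> polys_over S"
      using set(1) S 
      by (auto simp: polys_over_def nth_default_def is_subfield_def) (metis length_rev nth_mem set_rev subsetD)
    ultimately show "x \<in> algebraics S" using p(3) unfolding algebraics_def eval ops by blast
  next
    assume "x \<in> algebraics S"
    then obtain p where p: "p \<in> polys_over S" "p \<noteq> 0" "poly p x = 0" unfolding algebraics_def by blast
    have "set (coeffs p) \<subseteq> S" using p(1) by (rule set_coeffs_subset)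
    moreover have "hd (rev (coeffs p)) \<noteq> 0" using p(2) by (simp add: hd_rev last_coeffs_eq_coeff_degree)
    ultimately have "rev (coeffs p) \<in> carrier (S[X]\<^bsub>R\<^esub>)"
      using p(2) by (auto simp: univ_poly_def polynomial_def ops)
    then show "(R.algebraic over S) x"
      by (rule R.algebraicI) (use p in \<open>auto simp: eval ops\<close>)
  qed
  show "K \<subseteq> algebraics K"
  proof
    fix x assume "x \<in> K"
    then have "[:- x, 1:] \<in> polys_over K"
      using K by (auto simp: pCons_in_polys_over_iff zero_in_polys_over is_subfield_def)
    then show "x \<in> algebraics K" unfolding algebraics_def
      by (intro CollectI bexI[of _ "[:- x, 1:]"]) auto
  qed
  have KR: "subfield K R" using K subfield by blast
  have "{x \<in> carrier R. (R.algebraic over K) x} = algebraics K"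
    using alg[OF K] by (auto simp: ops)
  then have sub: "is_subfield (algebraics K)"
    using R.subfield_of_algebraics[OF KR] subfield by simp
  moreover have "z \<in> algebraics K"
    if p: "p \<in> polys_over (algebraics K)" "p \<noteq> 0" "poly p z = 0" for p z
  proof -
    define L where "L = R.finite_extension K (coeffs p)"
    have cs: "set (coeffs p) \<subseteq> carrier R" by (simp add: ops)
    have cs_alg: "(R.algebraic over K) x" if "x \<in> set (coeffs p)" for x
      using that set_coeffs_subset[OF p(1)] alg[OF K] by blast
    have L: "subfield L R"
      unfolding L_def by (rule R.finite_extension_is_subfield[OF KR cs cs_alg])
    have fin: "R.finite_dimension K L"
      unfolding L_def by (rule R.finite_extension_finite_dimension(1)[OF KR cs cs_alg])
    have "set (coeffs p) \<subseteq> L"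
      unfolding L_def by (rule R.finite_extension_mem[OF subfieldE(1)[OF KR] cs])
    moreover have "0 \<in> L" using L subfield by (auto simp: is_subfield_def)
    ultimately have "insert 0 (set (coeffs p)) \<subseteq> L" by simp
    then have "range (coeff p) \<subseteq> L" unfolding range_coeff .
    then have "p \<in> polys_over L" by (auto simp: polys_over_def)
    then have zL: "(R.algebraic over L) z"
      using p alg[of L z] L subfield by (auto simp: algebraics_def)
    have z: "z \<in> carrier R" by (simp add: ops)
    have "R.finite_dimension L (R.simple_extension L z)"
      using R.finite_dimension_simple_extension[OF L z] zL by blast
    then have "R.finite_dimension K (R.simple_extension L z)"
      by (rule R.telescopic_base_dim(1)[OF KR L fin])
    then have "(R.algebraic over K) z"
      using R.finite_dimension_imp_algebraic[OF KR
          R.simple_extension_is_subring[OF subfieldE(1)[OF L] z] _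
          R.simple_extension_mem[OF subfieldE(1)[OF L] z]] by blast
    then show ?thesis using alg[OF K] by blast
  qed
  ultimately show "rac (algebraics K)" unfolding rac_def by blast
qed

subsection \<open>The exchange property\<close>

definition fractions :: "'a::field set \<Rightarrow> 'a set" where
  "fractions R = {a / b | a b. a \<in> R \<and> b \<in> R \<and> b \<noteq> 0}"

lemma fractionsI: "a \<in> R \<Longrightarrow> b \<in> R \<Longrightarrow> b \<noteq> 0 \<Longrightarrow> a / b \<in> fractions R"
  by (auto simp: fractions_def)

lemma is_subfield_fractions:
  assumes R: "is_subring R"
  shows "is_subfield (fractions R)" and "R \<subseteq> fractions R"
proof -
  note RD = is_subringD[OF R]
  show sub: "R \<subseteq> fractions R"
    using fractionsI[OF _ RD(2)] by fastforce
  show "is_subfield (fractions R)"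
    unfolding is_subfield_def
  proof (intro conjI ballI)
    show "0 \<in> fractions R" "1 \<in> fractions R" using sub RD by auto
  next
    fix x y assume "x \<in> fractions R" "y \<in> fractions R"
    then obtain a b c d where x: "x = a / b" "a \<in> R" "b \<in> R" "b \<noteq> 0" and y: "y = c / d" "c \<in> R" "d \<in> R" "d \<noteq> 0"
      unfolding fractions_def by blast
    have "x + y = (a * d + c * b) / (b * d)" using x y by (simp add: field_simps)
    then show "x + y \<in> fractions R" using x y RD by (auto intro: fractionsI)
    have "x * y = (a * c) / (b * d)" using x y by simp
    then show "x * y \<in> fractions R" using x y RD by (auto intro: fractionsI)
  next
    fix x assume "x \<in> fractions R"
    then obtain a b where x: "x = a / b" "a \<in> R" "b \<in> R" "b \<noteq> 0"
      unfolding fractions_def by blast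
    have "- x = (- a) / b" using x by simp
    then show "- x \<in> fractions R" using fractionsI[of "- a" R b] x RD by metis
    show "inverse x \<in> fractions R"
    proof (cases "a = 0")
      case True
      then show ?thesis using x sub RD(1) by auto
    next
      case False
      have "inverse x = b / a" using x by simp
      then show ?thesis using fractionsI[of b R a] x False by metis
    qed
  qed
qed

lemma clear_denominators:
  assumes R: "is_subring R"
  shows "p \<in> polys_over (fractions R) \<Longrightarrow> \<exists>d\<in>R. d \<noteq> 0 \<and> smult d p \<in> polys_over R"
proof (induction p)
  case 0
  show ?case using is_subringD[OF R] by (intro bexI[of _ 1]) (auto simp: zero_in_polys_over)
next
  case (pCons a p)
  then obtain d where d: "d \<in> R" "d \<noteq> 0" "smult d p \<in> polys_over R"
    by (auto simp: pCons_in_polys_over_iff)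
  obtain m n where a: "a = m / n" "m \<in> R" "n \<in> R" "n \<noteq> 0"
    using pCons.prems unfolding pCons_in_polys_over_iff fractions_def by blast
  have "smult (n * d) (pCons a p) = pCons (m * d) (smult n (smult d p))"
    using a by simp
  also have "\<dots> \<in> polys_over R"
    using a d is_subringD[OF R] by (auto simp: pCons_in_polys_over_iff intro!: smult_in_polys_over[OF R] simp del: smult_smult)
  finally show ?case using a d is_subringD[OF R] by (intro bexI[of _ "n * d"]) auto
qed

text \<open>
  If \<open>t\<close> were in the hull of \<open>K\<close> and \<open>y\<close>, it would satisfy a nontrivial equation with coefficients in \<open>K(y)\<close>,
  after clearing denominators in \<open>K[y]\<close>. This is a polynomial relation between \<open>y\<close> and \<open>t\<close>; ordered by powers of
  \<open>y\<close> it is an equation for \<open>y\<close> over \<open>K[t]\<close>, and it is not trivial since \<open>t\<close> is transcendental over \<open>K\<close>.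
\<close>

lemma rac_exchange:
  fixes K :: "'a::field set"
  assumes K: "rac K" and t: "t \<notin> K" and y: "y \<notin> rac hull (insert t K)"
  shows "t \<notin> rac hull (insert y K)"
proof
  assume t_in: "t \<in> rac hull (insert y K)"
  note KR = rac_is_subring[OF K]
  define R where "R = adjoin K y"
  have R: "is_subring R" unfolding R_def by (rule is_subring_adjoin[OF KR])
  have "insert y K \<subseteq> R" unfolding R_def by (rule insert_subset_adjoin[OF KR])
  then have "insert y K \<subseteq> algebraics (fractions R)"
    using is_subfield_fractions[OF R] rac_algebraics(2) by blast
  then have "rac hull (insert y K) \<subseteq> algebraics (fractions R)"
    using is_subfield_fractions[OF R] rac_algebraics(1) by (intro hull_minimal) auto
  then obtain P0 where P0: "P0 \<in> polys_over (fractions R)" "P0 \<noteq> 0" "poly P0 t = 0"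
    using t_in unfolding algebraics_def by blast
  then obtain d where d: "d \<noteq> 0" "smult d P0 \<in> polys_over R"
    using clear_denominators[OF R] by blast
  define P where "P = smult d P0"
  have P: "P \<in> polys_over R" "P \<noteq> 0" "poly P t = 0" using P0 d by (auto simp: P_def)
  have "\<exists>g\<in>polys_over K. coeff P i = poly g y" for i
    using polys_over_coeff[OF P(1), of i] unfolding R_def by (rule adjoinE) blast
  then obtain f where f: "\<And>i. f i \<in> polys_over K" "\<And>i. coeff P i = poly (f i) y"
    by metis
  define n where "n = degree P"
  \<comment> \<open>The relation as a polynomial in \<open>y\<close>; its coefficients are polynomials in \<open>t\<close>.\<close>
  define Q where "Q = (\<Sum>i\<le>n. smult (t ^ i) (f i))"
  define H where "H = rac hull (insert t K)"
  have H: "rac H" unfolding H_def by (rule rac_hull)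
  have KH: "K \<subseteq> H" and tH: "t \<in> H" unfolding H_def using hull_subset[of "insert t K" rac] by auto
  note HR = rac_is_subring[OF H]
  have "Q \<in> polys_over H"
    unfolding Q_def using f(1) polys_over_mono[OF KH] tH
    by (intro subring_sum[OF is_subring_polys_over[OF HR]] smult_in_polys_over[OF HR] subring_power[OF HR]) auto
  moreover have "poly Q y = poly P t"
    unfolding Q_def poly_altdef[of P] n_def by (simp add: poly_sum f(2) mult.commute)
  ultimately have "Q = 0" using rac_root[OF H] y P(3) unfolding H_def by metis
  have "coeff (f i) k = 0" if "i \<le> n" for i k
  proof -
    \<comment> \<open>The \<open>k\<close>-th coefficient of \<open>Q\<close> as a polynomial in \<open>t\<close>.\<close>
    define r where "r = (\<Sum>i\<le>n. monom (coeff (f i) k) i)"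
    have "r \<in> polys_over K"
      unfolding r_def using f(1) is_subringD(1)[OF KR]
      by (intro subring_sum[OF is_subring_polys_over[OF KR]] monom_in_polys_over) (auto simp: polys_over_coeff)
    moreover have "poly r t = coeff Q k"
      unfolding r_def Q_def by (simp add: poly_sum poly_monom coeff_sum mult.commute)
    ultimately have "r = 0" using rac_root[OF K] t \<open>Q = 0\<close> by (metis coeff_0)
    moreover have "coeff r i = coeff (f i) k"
      unfolding r_def coeff_sum using that by (simp add: coeff_monom)
    ultimately show ?thesis by simp
  qed
  then have "f n = 0" by (intro poly_eqI) simp
  then have "lead_coeff P = 0" using f(2)[of n] by (simp add: n_def)
  then show False using P(2) by simp
qed

subsection \<open>Cardinality of the hull\<close>

text \<open>
  One round of the field operations and of adding roots of polynomials. The hull is exhausted by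
  countably many rounds, none of which increases an infinite cardinality.
\<close>

definition root_step :: "'a::field set \<Rightarrow> 'a set" where
  "root_step S = S \<union> {0, 1} \<union> (\<lambda>(x, y). x + y) ` (S \<times> S) \<union> (\<lambda>(x, y). x * y) ` (S \<times> S)
     \<union> uminus ` S \<union> inverse ` S \<union> (\<Union>p\<in>Poly ` lists S - {0}. {z. poly p z = 0})"

lemma card_root_step:
  assumes S: "infinite S"
  shows "|root_step S| \<le>o |S|"
proof -
  have times: "|S \<times> S| \<le>o |S|" using card_of_Times_same_infinite[OF S] ordIso_iff_ordLeq by blast
  have fin: "|A| \<le>o |S|" if "finite A" for A :: "'a set"
    using that S by (meson card_of_ordLeq_finite card_of_ordLeq_infinite card_of_Well_order not_ordLeq_ordLess ordLess_imp_ordLeq ordLess_or_ordLeq)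
  have "|Poly ` lists S - {0}| \<le>o |Poly ` lists S|" by (rule card_of_mono1) auto
  then have "|Poly ` lists S - {0}| \<le>o |lists S|" using card_of_image ordLeq_transitive by blast
  moreover have "|lists S| \<le>o |S|" using card_of_lists_infinite[OF S] ordIso_iff_ordLeq by blast
  ultimately have I: "|Poly ` lists S - {0}| \<le>o |S|" using ordLeq_transitive by blast
  have roots: "|\<Union>p\<in>Poly ` lists S - {0}. {z. poly p z = 0}| \<le>o |S|"
    by (rule card_of_UNION_ordLeq_infinite[OF S I]) (auto intro!: fin poly_roots_finite)
  have image: "|f ` A| \<le>o |S|" if "|A| \<le>o |S|" for f :: "'b \<Rightarrow> 'a" and A
    using that card_of_image ordLeq_transitive by blast
  show ?thesis
    unfolding root_step_def
    by (intro card_of_Un_ordLeq_infinite[OF S] roots image times fin card_of_refl[THEN ordIso_imp_ordLeq]) auto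
qed

lemma card_rac_hull_infinite:
  assumes X: "infinite X"
  shows "|rac hull X| \<le>o |X|"
proof -
  define A where "A n = (root_step ^^ n) X" for n
  have A_Suc: "A (Suc n) = root_step (A n)" for n by (simp add: A_def)
  have "A n \<subseteq> A (Suc n)" for n unfolding A_Suc root_step_def by blast
  then have mono: "A m \<subseteq> A n" if "m \<le> n" for m n using that lift_Suc_mono_le[of A] by blast
  then have XA: "X \<subseteq> A n" for n using mono[of 0 n] by (simp add: A_def)
  have "|A n| \<le>o |X|" for n
  proof (induction n)
    case 0
    show ?case by (simp add: A_def card_of_mono1)
  next
    case (Suc n)
    have "infinite (A n)" using X XA finite_subset by blast
    then show ?case unfolding A_Suc
      by (rule ordLeq_transitive[OF card_root_step Suc.IH])
  qed
  moreover have "|UNIV :: nat set| \<le>o |X|" using X infinite_iff_card_of_nat by blast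
  ultimately have card: "|\<Union>n. A n| \<le>o |X|"
    using card_of_UNION_ordLeq_infinite[OF X, of UNIV A] by blast
  have two: "\<exists>n. x \<in> A n \<and> y \<in> A n" if xy: "x \<in> (\<Union>n. A n)" "y \<in> (\<Union>n. A n)" for x y
  proof -
    from xy(1) obtain m where m: "x \<in> A m" by (rule UN_E)
    from xy(2) obtain n where n: "y \<in> A n" by (rule UN_E)
    have "x \<in> A (max m n)" using m mono[of m "max m n"] by (meson max.cobounded1 subsetD)
    moreover have "y \<in> A (max m n)" using n mono[of n "max m n"] by (meson max.cobounded2 subsetD)
    ultimately show ?thesis by blast
  qed
  have A1: "{0, 1} \<subseteq> A (Suc n)" for n unfolding A_Suc root_step_def by auto
  have "rac (\<Union>n. A n)"
    unfolding rac_def is_subfield_def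
  proof (intro conjI ballI allI impI)
    show "0 \<in> (\<Union>n. A n)" "1 \<in> (\<Union>n. A n)" using A1 by blast+
  next
    fix x y assume "x \<in> (\<Union>n. A n)" "y \<in> (\<Union>n. A n)"
    then obtain n where "x \<in> A n" "y \<in> A n" using two by blast
    then have "x + y \<in> A (Suc n)" "x * y \<in> A (Suc n)" unfolding A_Suc root_step_def by force+
    then show "x + y \<in> (\<Union>n. A n)" "x * y \<in> (\<Union>n. A n)" by blast+
  next
    fix x assume "x \<in> (\<Union>n. A n)"
    then obtain n where "x \<in> A n" by blast
    then have "- x \<in> A (Suc n)" "inverse x \<in> A (Suc n)" unfolding A_Suc root_step_def by blast+
    then show "- x \<in> (\<Union>n. A n)" "inverse x \<in> (\<Union>n. A n)" by blast+
  next
    fix p z assume p: "p \<in> polys_over (\<Union>n. A n)" "p \<noteq> 0" "poly p z = 0"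
    have "(\<Union>n. A n) = \<Union>(range (\<lambda>n. A (Suc n)))"
    proof (intro equalityI UN_least)
      show "A n \<subseteq> \<Union>(range (\<lambda>n. A (Suc n)))" for n using mono[of n "Suc n"] by auto
    qed auto
    moreover have "A (Suc m) \<subseteq> A (Suc n) \<or> A (Suc n) \<subseteq> A (Suc m)" for m n
      using mono[of "Suc m" "Suc n"] mono[of "Suc n" "Suc m"] by linarith
    ultimately have "\<exists>B\<in>range (\<lambda>n. A (Suc n)). p \<in> polys_over B"
      using p(1) A1 by (intro polys_over_Union_chain) auto
    then obtain n where "p \<in> polys_over (A n)" by blast
    then have "coeffs p \<in> lists (A n)" using set_coeffs_subset by blast
    then have "p \<in> Poly ` lists (A n) - {0}" using p(2) by (metis DiffI Poly_coeffs image_eqI singletonD)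
    then have "z \<in> A (Suc n)" unfolding A_Suc root_step_def using p(3) by blast
    then show "z \<in> (\<Union>n. A n)" by blast
  qed
  then have "rac hull X \<subseteq> (\<Union>n. A n)" using XA by (intro hull_minimal) auto
  then show ?thesis using card card_of_mono1 ordLeq_transitive by blast
qed

text \<open>
  For finite \<open>X\<close> the hull may be countably infinite; the natural numbers are added to cover this case.
\<close>

lemma card_rac_hull_less:
  fixes X :: "'a::field_char_0 set"
  assumes X: "|X| <o \<kappa>" and \<kappa>: "|UNIV :: nat set| <o \<kappa>" "Card_order \<kappa>"
  shows "|rac hull X| <o \<kappa>"
proof -
  define Y where "Y = X \<union> range (of_nat :: nat \<Rightarrow> 'a)"
  have "infinite Y" using infinite_UNIV_nat by (auto simp: Y_def dest: finite_imageD simp: inj_of_nat)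
  have "|range (of_nat :: nat \<Rightarrow> 'a)| <o \<kappa>"
    using card_of_image \<kappa>(1) ordLeq_ordLess_trans by blast
  moreover have "infinite (Field \<kappa>)"
    using \<kappa> by (metis card_of_Field_ordIso card_of_ordLeq_infinite infinite_UNIV_nat ordLess_imp_ordLeq ordLess_ordIso_trans ordIso_symmetric)
  ultimately have "|Y| <o \<kappa>"
    unfolding Y_def using X \<kappa>(2) card_of_Un_ordLess_infinite_Field by blast
  moreover have "|rac hull X| \<le>o |rac hull Y|"
    by (rule card_of_mono1, rule hull_mono) (simp add: Y_def)
  ultimately show ?thesis
    using card_rac_hull_infinite[OF \<open>infinite Y\<close>] ordLeq_ordLess_trans by blast
qed

section \<open>Order-preserving correspondences\<close>

text \<open>
  With the componentwise ring structure on pairs, evaluating a polynomial over \<open>F \<times> F\<close> at a pair evaluates its two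
  component polynomials, and polynomials over a correspondence can be handled by ring operations that never
  mention the isomorphism.
\<close>

instantiation prod :: (comm_ring_1, comm_ring_1) comm_ring_1
begin

definition one_prod_def: "1 = (1, 1)"
definition times_prod_def: "x * y = (fst x * fst y, snd x * snd y)"

instance
  by standard (auto simp: one_prod_def times_prod_def zero_prod_def prod_eq_iff algebra_simps)

end

lemma prod_ring_simps [simp]:
  "fst (x * y) = fst x * fst y" "snd (x * y) = snd x * snd y" "fst 1 = 1" "snd 1 = 1"
  "(a, b) * (c, d) = (a * c, b * d)"
  by (simp_all add: times_prod_def one_prod_def)

lemma fst_poly: "fst (poly p z) = poly (map_poly fst p) (fst z)"
  for p :: "('a::comm_ring_1 \<times> 'b::comm_ring_1) poly"
  by (rule poly_map_poly_hom[symmetric]) simp_all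

lemma snd_poly: "snd (poly p z) = poly (map_poly snd p) (snd z)"
  for p :: "('a::comm_ring_1 \<times> 'b::comm_ring_1) poly"
  by (rule poly_map_poly_hom[symmetric]) simp_all

lemma map_poly_prod_simps:
  fixes p q :: "('a::comm_ring_1 \<times> 'b::comm_ring_1) poly"
  shows "map_poly fst (p + q) = map_poly fst p + map_poly fst q"
    "map_poly snd (p + q) = map_poly snd p + map_poly snd q"
    "map_poly fst (p * q) = map_poly fst p * map_poly fst q"
    "map_poly snd (p * q) = map_poly snd p * map_poly snd q"
    "map_poly fst (pCons c p) = pCons (fst c) (map_poly fst p)"
    "map_poly snd (pCons c p) = pCons (snd c) (map_poly snd p)"
    "map_poly fst (- p) = - map_poly fst p"
    "map_poly snd (- p) = - map_poly snd p"
  by (simp_all add: map_poly_hom_add map_poly_hom_mult map_poly_pCons poly_eq_iff coeff_map_poly)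

text \<open>
  The ring of pairs has zero divisors, so the derivative is characterized through the two components.
\<close>

lemma pderiv_of_pairs:
  fixes p :: "('a::{comm_ring_1,semiring_no_zero_divisors} \<times> 'b::{comm_ring_1,semiring_no_zero_divisors}) poly"
  assumes G: "is_subring G"
  shows "p \<in> polys_over G \<Longrightarrow> \<exists>d\<in>polys_over G.
    map_poly fst d = pderiv (map_poly fst p) \<and> map_poly snd d = pderiv (map_poly snd p)"
proof (induction p)
  case 0
  show ?case using is_subringD[OF G] by (intro bexI[of _ 0]) (auto simp: zero_in_polys_over)
next
  case (pCons a p)
  then obtain d where d: "d \<in> polys_over G"
      "map_poly fst d = pderiv (map_poly fst p)" "map_poly snd d = pderiv (map_poly snd p)" and p: "p \<in> polys_over G"
    by (auto simp: pCons_in_polys_over_iff)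
  have "p + pCons 0 d \<in> polys_over G"
    using p d(1) is_subringD(1)[OF G]
    by (intro is_subringD(3)[OF is_subring_polys_over[OF G]]) (auto simp: pCons_in_polys_over_iff)
  then show ?case using d
    by (intro bexI[of _ "p + pCons 0 d"]) (simp_all add: map_poly_prod_simps pderiv_pCons)
qed

text \<open>
  The graphs of order isomorphisms between subrings of the field. Equality of signs for all elements of the
  subring entails, by subtraction, that the relation is single-valued, injective and monotone.
\<close>

definition coherent :: "('a::linordered_field \<times> 'a) set \<Rightarrow> bool" where
  "coherent G \<longleftrightarrow> is_subring G \<and> (\<forall>(a, b)\<in>G. 0 < a \<longleftrightarrow> 0 < b)"

lemma coherent_is_subring: "coherent G \<Longrightarrow> is_subring G"
  by (simp add: coherent_def)

lemma coherent_pos: "coherent G \<Longrightarrow> (a, b) \<in> G \<Longrightarrow> 0 < a \<longleftrightarrow> 0 < b"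
  by (auto simp: coherent_def)

lemma coherent_less:
  assumes "coherent G" "(a, b) \<in> G" "(c, d) \<in> G"
  shows "a < c \<longleftrightarrow> b < d"
proof -
  have "(c, d) - (a, b) \<in> G" using assms coherent_is_subring is_subringD(6) by blast
  then show ?thesis using coherent_pos[OF assms(1), of "c - a" "d - b"] by simp
qed

lemma coherent_eq:
  assumes "coherent G" "(a, b) \<in> G" "(c, d) \<in> G"
  shows "a = c \<longleftrightarrow> b = d"
  using coherent_less[OF assms] coherent_less[OF assms(1,3,2)] by (metis linorder_neqE_linordered_idom order_less_irrefl)

lemma coherent_zero:
  assumes "coherent G" "(a, b) \<in> G"
  shows "a = 0 \<longleftrightarrow> b = 0"
  using coherent_eq[OF assms, of 0 0] is_subringD(1)[OF coherent_is_subring[OF assms(1)]]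
  by (simp add: zero_prod_def)

lemma coherent_subset: "coherent G \<Longrightarrow> is_subring H \<Longrightarrow> H \<subseteq> G \<Longrightarrow> coherent H"
  by (auto simp: coherent_def)

lemma coherent_poly_in:
  assumes "coherent G" "p \<in> polys_over G" "(a, b) \<in> G"
  shows "(poly (map_poly fst p) a, poly (map_poly snd p) b) \<in> G"
  using poly_in_subring[OF coherent_is_subring[OF assms(1)] assms(3,2)]
  by (metis fst_poly snd_poly fst_conv snd_conv prod.collapse)

lemma coherent_degree:
  assumes G: "coherent G" and p: "p \<in> polys_over G"
  shows "degree (map_poly fst p) = degree p" "degree (map_poly snd p) = degree p"
    "map_poly fst p = 0 \<longleftrightarrow> p = 0" "map_poly snd p = 0 \<longleftrightarrow> p = 0"
proof -
  have "fst (coeff p i) = 0 \<longleftrightarrow> snd (coeff p i) = 0" for i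
    using coherent_zero[OF G] polys_over_coeff[OF p] by (metis prod.collapse)
  then have *: "fst (coeff p i) = 0 \<longleftrightarrow> coeff p i = 0" "snd (coeff p i) = 0 \<longleftrightarrow> coeff p i = 0" for i
    by (auto simp: prod_eq_iff)
  show "degree (map_poly fst p) = degree p" "degree (map_poly snd p) = degree p"
    by (simp_all add: Polynomial.degree_def coeff_map_poly *)
  show "map_poly fst p = 0 \<longleftrightarrow> p = 0" "map_poly snd p = 0 \<longleftrightarrow> p = 0"
    by (auto simp: poly_eq_iff coeff_map_poly *)
qed

text \<open>
  Both projections of \<open>G\<close> contain every root, in the ambient field, of any polynomial over \<open>G\<close> of degree
  less than \<open>n\<close>. The condition is symmetric in the two components, so that
  a component polynomial without roots forces the other one to have no roots either.
\<close>

definition contains_roots_below :: "nat \<Rightarrow> ('a::linordered_field \<times> 'a) set \<Rightarrow> bool" where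
  "contains_roots_below n G \<longleftrightarrow> (\<forall>p\<in>polys_over G. p \<noteq> 0 \<longrightarrow> degree p < n \<longrightarrow>
     (\<forall>a. poly (map_poly fst p) a = 0 \<longrightarrow> a \<in> fst ` G) \<and>
     (\<forall>b. poly (map_poly snd p) b = 0 \<longrightarrow> b \<in> snd ` G))"

text \<open>
  The sign of a polynomial at \<open>x\<close> depends only on the cut of \<open>x\<close>. Split off roots: a root \<open>a\<close> of the first component
  lies in the projection of \<open>G\<close>, its partner \<open>b\<close> is a root of the second component, and \<open>x - a\<close> and \<open>y - b\<close> have the
  same sign. When the first component has no more roots, neither has the second, so both have constant sign and can
  be compared at \<open>(0, 0)\<close>.
\<close>

lemma sign_transfer:
  fixes G :: "('a::linordered_field \<times> 'a) set"
  assumes rc: "real_closed TYPE('a)" and G: "coherent G" and H: "contains_roots_below n G"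
    and xy: "x \<notin> fst ` G" "y \<notin> snd ` G" and cut: "\<And>a b. (a, b) \<in> G \<Longrightarrow> a < x \<longleftrightarrow> b < y"
    and p: "p \<in> polys_over G" "p \<noteq> 0" "degree p < n"
  shows "0 < poly (map_poly fst p) x \<longleftrightarrow> 0 < poly (map_poly snd p) y"
  using p
proof (induction "degree p" arbitrary: p rule: less_induct)
  case less
  note GR = coherent_is_subring[OF G]
  note deg = coherent_degree[OF G less.prems(1)]
  have roots: "poly (map_poly fst p) a = 0 \<Longrightarrow> a \<in> fst ` G"
      "poly (map_poly snd p) b = 0 \<Longrightarrow> b \<in> snd ` G" for a b
    using H less.prems unfolding contains_roots_below_def by blast+
  show ?case
  proof (cases "\<exists>a. poly (map_poly fst p) a = 0")
    case True
    then obtain a where a: "poly (map_poly fst p) a = 0" by blast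
    then obtain b where ab: "(a, b) \<in> G" using roots(1)[of a] by force
    have "poly (map_poly snd p) b = 0"
      using coherent_zero[OF G coherent_poly_in[OF G less.prems(1) ab]] a by simp
    then have "poly p (a, b) = 0"
      using a fst_poly[of p "(a, b)"] snd_poly[of p "(a, b)"] by (simp add: prod_eq_iff)
    define q where "q = synthetic_div p (a, b)"
    have pq: "p = [:- (a, b), 1:] * q"
      using synthetic_div_correct'[of "(a, b)" p] \<open>poly p (a, b) = 0\<close> by (simp add: q_def)
    have q: "q \<in> polys_over G" unfolding q_def by (rule synthetic_div_in_polys_over[OF GR ab less.prems(1)])
    have "q \<noteq> 0" using pq less.prems(2) by auto
    have fp: "map_poly fst p = [:- a, 1:] * map_poly fst q"
      unfolding pq map_poly_prod_simps by simp
    have sp: "map_poly snd p = [:- b, 1:] * map_poly snd q"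
      unfolding pq map_poly_prod_simps by simp
    have "degree p = Suc (degree q)"
      unfolding deg(1)[symmetric] coherent_degree(1)[OF G q, symmetric] fp
      using \<open>q \<noteq> 0\<close> coherent_degree(3)[OF G q] by (subst degree_mult_eq) auto
    then have IH: "0 < poly (map_poly fst q) x \<longleftrightarrow> 0 < poly (map_poly snd q) y"
      using less.hyps[OF _ q \<open>q \<noteq> 0\<close>] less.prems(3) by simp
    have q0: "poly (map_poly fst q) x \<noteq> 0" "poly (map_poly snd q) y \<noteq> 0"
      using H q \<open>q \<noteq> 0\<close> \<open>degree p = Suc (degree q)\<close> less.prems(3) xy unfolding contains_roots_below_def by force+
    have "x \<noteq> a" "y \<noteq> b" using ab xy by force+
    then have "0 < x - a \<longleftrightarrow> 0 < y - b" using cut[OF ab] by auto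
    moreover have "poly (map_poly fst p) x = (x - a) * poly (map_poly fst q) x"
      "poly (map_poly snd p) y = (y - b) * poly (map_poly snd q) y"
      unfolding fp sp by (simp_all add: algebra_simps)
    ultimately show ?thesis
      using IH q0 \<open>x \<noteq> a\<close> \<open>y \<noteq> b\<close> by (auto simp: zero_less_mult_iff)
  next
    case False
    have no2: "poly (map_poly snd p) b \<noteq> 0" for b
    proof
      assume b: "poly (map_poly snd p) b = 0"
      then obtain a where ab: "(a, b) \<in> G" using roots(2)[of b] by force
      have "poly (map_poly fst p) a = 0"
        using coherent_zero[OF G coherent_poly_in[OF G less.prems(1) ab]] b by simp
      then show False using False by blast
    qed
    have "(0, 0) \<in> G" using is_subringD(1)[OF GR] by (simp add: zero_prod_def)
    then have "0 < poly (map_poly fst p) 0 \<longleftrightarrow> 0 < poly (map_poly snd p) 0"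
      using coherent_pos[OF G coherent_poly_in[OF G less.prems(1)]] by blast
    then show ?thesis
      using constant_sign_if_no_root[OF rc, of "map_poly fst p" x 0] False
        constant_sign_if_no_root[OF rc, of "map_poly snd p" y 0] no2 by blast
  qed
qed

lemma coherent_adjoin_if_sign_transfer:
  assumes G: "coherent G"
    and "\<And>p. p \<in> polys_over G \<Longrightarrow> \<exists>q\<in>polys_over G. poly q (x, y) = poly p (x, y) \<and>
       (0 < poly (map_poly fst q) x \<longleftrightarrow> 0 < poly (map_poly snd q) y)"
  shows "coherent (adjoin G (x, y))"
  unfolding coherent_def
proof (intro conjI ballI)
  show "is_subring (adjoin G (x, y))" by (rule is_subring_adjoin[OF coherent_is_subring[OF G]])
  fix z assume "z \<in> adjoin G (x, y)"
  then obtain p where "p \<in> polys_over G" "z = poly p (x, y)" by (rule adjoinE)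
  then obtain q where "z = poly q (x, y)" "0 < poly (map_poly fst q) x \<longleftrightarrow> 0 < poly (map_poly snd q) y"
    using assms(2) by metis
  then show "case z of (a, b) \<Rightarrow> 0 < a \<longleftrightarrow> 0 < b"
    using fst_poly[of q "(x, y)"] snd_poly[of q "(x, y)"] by (auto simp: case_prod_beta)
qed

text \<open>
  When all roots of polynomials over \<open>G\<close> lie in the projections, the new elements \<open>x\<close> and \<open>y\<close> are
  transcendental and any two elements in corresponding cuts match.
\<close>

lemma coherent_adjoin_transcendental:
  fixes G :: "('a::linordered_field \<times> 'a) set"
  assumes rc: "real_closed TYPE('a)" and G: "coherent G" and H: "\<And>n. contains_roots_below n G"
    and xy: "x \<notin> fst ` G" "y \<notin> snd ` G" and cut: "\<And>a b. (a, b) \<in> G \<Longrightarrow> a < x \<longleftrightarrow> b < y"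
  shows "coherent (adjoin G (x, y))"
proof (rule coherent_adjoin_if_sign_transfer[OF G])
  fix p assume p: "p \<in> polys_over G"
  have "0 < poly (map_poly fst p) x \<longleftrightarrow> 0 < poly (map_poly snd p) y"
    using sign_transfer[OF rc G H xy cut p, of "Suc (degree p)"] by (cases "p = 0") auto
  then show "\<exists>q\<in>polys_over G. poly q (x, y) = poly p (x, y) \<and>
      (0 < poly (map_poly fst q) x \<longleftrightarrow> 0 < poly (map_poly snd q) y)"
    using p by blast
qed

subsection \<open>Adjoining an algebraic element\<close>

lemma reduce_modulo_polynomial:
  fixes p q :: "'a::comm_ring_1 poly"
  assumes S: "is_subring S" and p: "p \<in> polys_over S" "poly p z = 0" and n: "degree p = n" "n > 0"
    and u: "u \<in> S" "u * lead_coeff p = 1"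
  shows "q \<in> polys_over S \<Longrightarrow> \<exists>r\<in>polys_over S. degree r < n \<and> poly r z = poly q z"
proof (induction "degree q" arbitrary: q rule: less_induct)
  case less
  note P = is_subringD[OF is_subring_polys_over[OF S]]
  show ?case
  proof (cases "degree q < n")
    case True
    then show ?thesis using less.prems by blast
  next
    case False
    define m where "m = degree q"
    define r where "r = q - monom (lead_coeff q * u) (m - n) * p"
    have mn: "m \<ge> n" using False m_def by simp
    have r: "r \<in> polys_over S"
      unfolding r_def using p(1) u less.prems is_subringD[OF S]
      by (intro P(6) P(4) monom_in_polys_over) (auto simp: polys_over_coeff)
    have val: "poly r z = poly q z" by (simp add: r_def p)
    have "degree (monom (lead_coeff q * u) (m - n) * p) \<le> m"
      using degree_mult_le[of "monom (lead_coeff q * u) (m - n)" p] degree_monom_le[of "lead_coeff q * u" "m - n"] mn n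
      by linarith
    then have "degree r \<le> m" unfolding r_def by (intro degree_diff_le) (simp_all add: m_def)
    moreover have "coeff r m = 0"
      using coeff_monom_mult[of "lead_coeff q * u" "m - n" p m] mn u(2) n
      by (simp add: r_def m_def mult.assoc)
    ultimately have "r = 0 \<or> degree r < m"
      by (metis le_neq_implies_less leading_coeff_0_iff)
    then have "degree r < m" using n mn by auto
    then show ?thesis using less.hyps[of r] r val m_def by auto
  qed
qed

text \<open>
  Roots of a polynomial are bounded by an element of its coefficient field. The stronger statement that
  \<open>p\<close> is bounded away from zero outside a bounded set is what the induction on the coefficients needs:
  for degree at least one it is obtained with \<open>e = 1\<close> from \<open>\<bar>z\<bar> * \<bar>p z\<bar> > 1 + \<bar>a\<bar>\<close>.
\<close>

lemma roots_bounded_in_subfield: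
  fixes K :: "'a::linordered_field set"
  assumes K: "is_subfield K"
  shows "p \<in> polys_over K \<Longrightarrow> p \<noteq> 0 \<Longrightarrow>
    \<exists>B\<in>K. \<exists>e\<in>K. 0 < e \<and> (\<forall>z. B < \<bar>z\<bar> \<longrightarrow> e \<le> \<bar>poly p z\<bar>)"
proof (induction p)
  case 0
  then show ?case by simp
next
  case (pCons a p)
  note KR = is_subringD[OF is_subfield_imp_is_subring[OF K]]
  have a: "a \<in> K" "p \<in> polys_over K" using pCons.prems by (auto simp: pCons_in_polys_over_iff)
  then have absa: "\<bar>a\<bar> \<in> K" using KR by (auto simp: abs_if)
  show ?case
  proof (cases "p = 0")
    case True
    then show ?thesis using pCons.prems absa KR(1) by (intro bexI[of _ 0] bexI[of _ "\<bar>a\<bar>"]) auto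
  next
    case False
    then obtain B e where B: "B \<in> K" "e \<in> K" "0 < e" "\<And>z. B < \<bar>z\<bar> \<Longrightarrow> e \<le> \<bar>poly p z\<bar>"
      using pCons.IH a by blast
    define C where "C = max B ((1 + \<bar>a\<bar>) / e)"
    have "C \<in> K" unfolding C_def max_def using B absa KR by (auto intro!: subfield_divide[OF K])
    moreover have "1 \<le> \<bar>poly (pCons a p) z\<bar>" if "C < \<bar>z\<bar>" for z
    proof -
      have "(1 + \<bar>a\<bar>) / e < \<bar>z\<bar>" "B < \<bar>z\<bar>" using that unfolding C_def by auto
      then have "1 + \<bar>a\<bar> < \<bar>z\<bar> * e" using B(3) by (simp add: pos_divide_less_eq)
      also have "\<dots> \<le> \<bar>z\<bar> * \<bar>poly p z\<bar>" using B(4)[OF \<open>B < \<bar>z\<bar>\<close>] by (intro mult_left_mono) auto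
      also have "\<dots> = \<bar>z * poly p z\<bar>" by (simp add: abs_mult)
      finally show ?thesis by simp
    qed
    ultimately show ?thesis using KR(2) by (intro bexI[of _ C] bexI[of _ 1]) auto
  qed
qed

text \<open>
  Let \<open>f\<close> and \<open>g\<close> be the components of \<open>p\<close>. The derivatives have smaller degree, so the critical points of \<open>f\<close> and
  of \<open>g\<close> lie in the projections of \<open>G\<close> and correspond to each other. Let \<open>c < r < c'\<close> be the
  neighbours of \<open>r\<close> among these critical points and two bounds for the roots of \<open>f\<close> in the field of coefficients. Then \<open>f\<close> is
  increasing on \<open>[c, c']\<close> and changes sign, hence \<open>g\<close> is increasing and changes sign between the partners
  \<open>e < e'\<close>; let \<open>s\<close> be its root there. For a pair \<open>(a, b)\<close> in between, \<open>a < r\<close> means \<open>f a < 0\<close> and \<open>b < s\<close>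
  means \<open>g b < 0\<close>, so \<open>r\<close> and \<open>s\<close> make the same cut. As polynomials can be reduced modulo \<open>p\<close>, the sign transfer
  below degree \<open>n\<close> suffices for all of them.
\<close>

lemma coherent_adjoin_algebraic_increasing:
  fixes G :: "('a::linordered_field \<times> 'a) set"
  assumes rc: "real_closed TYPE('a)" and G: "coherent G"
    and inv: "\<And>a b. (a, b) \<in> G \<Longrightarrow> (inverse a, inverse b) \<in> G"
    and H: "contains_roots_below n G" and p: "p \<in> polys_over G" "p \<noteq> 0" "degree p = n"
    and r: "poly (map_poly fst p) r = 0" "r \<notin> fst ` G"
    and increasing: "0 < poly (pderiv (map_poly fst p)) r"
  shows "\<exists>s. poly (map_poly snd p) s = 0 \<and> coherent (adjoin G (r, s))"
proof -
  note GR = is_subringD[OF coherent_is_subring[OF G]]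
  define f g where "f = map_poly fst p" and "g = map_poly snd p"
  have val: "(poly f a, poly g b) \<in> G" if "(a, b) \<in> G" for a b
    unfolding f_def g_def by (rule coherent_poly_in[OF G p(1) that])
  have f: "f \<noteq> 0" "degree f = n" using p coherent_degree[OF G p(1)] by (simp_all add: f_def)
  have "degree f \<noteq> 0"
  proof
    assume "degree f = 0"
    then obtain c where "f = [:c:]" by (rule degree_eq_zeroE)
    then show False using r(1) f(1) unfolding f_def[symmetric] by simp
  qed
  then have n: "n > 0" using f by simp
  obtain d where d: "d \<in> polys_over G" "map_poly fst d = pderiv f" "map_poly snd d = pderiv g"
    using pderiv_of_pairs[OF coherent_is_subring[OF G] p(1)] unfolding f_def g_def by blast
  have "pderiv f \<noteq> 0" using increasing unfolding f_def by auto
  then have "d \<noteq> 0" using d(2) by auto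
  have "degree d < n"
    using coherent_degree(1)[OF G d(1)] n f(2) unfolding d(2) by (simp add: degree_pderiv)
  then have d_roots: "poly (pderiv f) a = 0 \<Longrightarrow> a \<in> fst ` G" "poly (pderiv g) b = 0 \<Longrightarrow> b \<in> snd ` G" for a b
    using H d \<open>d \<noteq> 0\<close> unfolding contains_roots_below_def by metis+
  have d_val: "(poly (pderiv f) a, poly (pderiv g) b) \<in> G" if "(a, b) \<in> G" for a b
    using coherent_poly_in[OF G d(1) that] unfolding d(2,3) .

  have K: "is_subfield (fst ` G)"
    unfolding is_subfield_def
  proof (intro conjI ballI)
    show "0 \<in> fst ` G" "1 \<in> fst ` G" using imageI[OF GR(1), of fst] imageI[OF GR(2), of fst] by simp_all
    fix x assume "x \<in> fst ` G"
    then obtain a where a: "a \<in> G" "x = fst a" by blast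
    show "- x \<in> fst ` G" using imageI[OF GR(5)[OF a(1)], of fst] a by simp
    show "inverse x \<in> fst ` G" using inv[of "fst a" "snd a"] a by force
    fix y assume "y \<in> fst ` G"
    then obtain b where b: "b \<in> G" "y = fst b" by blast
    show "x + y \<in> fst ` G" "x * y \<in> fst ` G"
      using imageI[OF GR(3)[OF a(1) b(1)], of fst] imageI[OF GR(4)[OF a(1) b(1)], of fst] a b by simp_all
  qed
  have "f \<in> polys_over (fst ` G)"
    using p(1) by (auto simp: f_def polys_over_def coeff_map_poly)
  then obtain B e where B: "B \<in> fst ` G" "0 < e" "\<And>z. B < \<bar>z\<bar> \<Longrightarrow> e \<le> \<bar>poly f z\<bar>"
    using roots_bounded_in_subfield[OF K _ f(1)] by blast
  have "\<bar>r\<bar> \<le> B" using B(2) B(3)[of r] r(1) unfolding f_def[symmetric] by force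
  have B1: "B + 1 \<in> fst ` G" "- (B + 1) \<in> fst ` G"
    using B(1) is_subringD[OF is_subfield_imp_is_subring[OF K]] by simp_all
  \<comment> \<open>The two bounds make both sets below nonempty, so that \<open>c\<close> and \<open>c'\<close> exist in every case.\<close>
  define T where "T = insert (B + 1) (insert (- (B + 1)) {z. poly (pderiv f) z = 0})"
  have T: "finite T" "T \<subseteq> fst ` G"
    unfolding T_def using poly_roots_finite[OF \<open>pderiv f \<noteq> 0\<close>] B1 d_roots by auto
  define c c' where "c = Max {z\<in>T. z < r}" and "c' = Min {z\<in>T. r < z}"
  have fin: "finite {z\<in>T. z < r}" "finite {z\<in>T. r < z}" using T(1) by simp_all
  have "- (B + 1) \<in> {z\<in>T. z < r}" "B + 1 \<in> {z\<in>T. r < z}"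
    using \<open>\<bar>r\<bar> \<le> B\<close> by (auto simp: T_def)
  then have c: "c \<in> {z\<in>T. z < r}" "c' \<in> {z\<in>T. r < z}"
    unfolding c_def c'_def using Max_in[OF fin(1)] Min_in[OF fin(2)] by blast+
  have c_max: "\<And>z. z \<in> T \<Longrightarrow> z < r \<Longrightarrow> z \<le> c" and c_min: "\<And>z. z \<in> T \<Longrightarrow> r < z \<Longrightarrow> c' \<le> z"
    unfolding c_def c'_def using Max_ge[OF fin(1)] Min_le[OF fin(2)] by blast+
  have crc: "c < r" "r < c'" using c by auto
  obtain e e' where e: "(c, e) \<in> G" "(c', e') \<in> G" using c T(2) by force
  have "e < e'" using coherent_less[OF G e] crc by simp
  have no_f: "poly (pderiv f) z \<noteq> 0" if "c < z" "z < c'" for z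
  proof
    assume z: "poly (pderiv f) z = 0"
    then have "z \<in> T" "z \<noteq> r" using d_roots(1) r(2) by (auto simp: T_def)
    then show False using c_max[of z] c_min[of z] that by fastforce
  qed
  have no_g: "poly (pderiv g) w \<noteq> 0" if "e < w" "w < e'" for w
  proof
    assume w: "poly (pderiv g) w = 0"
    then obtain z where z: "(z, w) \<in> G" using d_roots(2)[of w] by force
    then have "poly (pderiv f) z = 0" using coherent_zero[OF G d_val[OF z]] w by simp
    then show False
      using no_f[of z] coherent_less[OF G e(1) z] coherent_less[OF G z e(2)] that by simp
  qed
  have mono_f: "poly f u < poly f v" if "c \<le> u" "u < v" "v \<le> c'" for u v
    using poly_strictly_monotone_if_no_critical_point[OF rc no_f crc that] increasing
    unfolding f_def by blast
  have fr: "poly f r = 0" using r(1) by (simp add: f_def)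
  have "poly f c < 0" "0 < poly f c'" using mono_f[of c r] mono_f[of r c'] crc fr by auto
  then have "0 < poly g e'" "poly g e < 0"
    using coherent_pos[OF G val[OF e(2)]] coherent_less[OF G val[OF e(1)], of 0 0] GR(1)
    by (auto simp: zero_prod_def)
  then have "poly g e * poly g e' < 0" by (simp add: mult_neg_pos)
  then obtain s where s: "e < s" "s < e'" "poly g s = 0"
    using poly_IVT_real_closed[OF rc \<open>e < e'\<close>] by blast
  have "0 < poly (pderiv g) s"
    using poly_strictly_monotone_if_no_critical_point[OF rc no_g s(1,2), of e e'] \<open>e < e'\<close>
      \<open>0 < poly g e'\<close> \<open>poly g e < 0\<close> by auto
  then have mono_g: "poly g u < poly g v" if "e \<le> u" "u < v" "v \<le> e'" for u v
    using poly_strictly_monotone_if_no_critical_point[OF rc no_g s(1,2) that] by blast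
  have s_notin: "s \<notin> snd ` G"
  proof
    assume "s \<in> snd ` G"
    then obtain a where a: "(a, s) \<in> G" by force
    have "c < a" "a < c'" using coherent_less[OF G e(1) a] coherent_less[OF G a e(2)] s by auto
    moreover have "poly f a = 0" using coherent_zero[OF G val[OF a]] s(3) by simp
    ultimately have "a = r"
      using mono_f[of a r] mono_f[of r a] crc fr by (cases a r rule: linorder_cases) auto
    then show False using a r(2) by force
  qed
  have cut: "a < r \<longleftrightarrow> b < s" if ab: "(a, b) \<in> G" for a b
  proof -
    have ne: "a \<noteq> r" "b \<noteq> s" using ab r(2) s_notin by force+
    consider "a \<le> c" | "c' \<le> a" | "c < a" "a < c'" by fastforce
    then show ?thesis
    proof cases
      case 1
      then have "b \<le> e" using coherent_less[OF G e(1) ab] by simp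
      then show ?thesis using 1 s crc by auto
    next
      case 2
      then have "e' \<le> b" using coherent_less[OF G ab e(2)] by simp
      then show ?thesis using 2 s crc by auto
    next
      case 3
      then have b: "e < b" "b < e'"
        using coherent_less[OF G e(1) ab] coherent_less[OF G ab e(2)] by auto
      have "a < r \<longleftrightarrow> poly f a < 0"
        using mono_f[of a r] mono_f[of r a] 3 crc fr ne(1) by (cases a r rule: linorder_cases) auto
      also have "\<dots> \<longleftrightarrow> poly g b < 0"
        using coherent_less[OF G val[OF ab], of 0 0] GR(1) by (simp add: zero_prod_def)
      also have "\<dots> \<longleftrightarrow> b < s"
        using mono_g[of b s] mono_g[of s b] b s ne(2) by (cases b s rule: linorder_cases) auto
      finally show ?thesis .
    qed
  qed
  have "coherent (adjoin G (r, s))"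
  proof (rule coherent_adjoin_if_sign_transfer[OF G])
    fix q assume q: "q \<in> polys_over G"
    define u where "u = (inverse (fst (lead_coeff p)), inverse (snd (lead_coeff p)))"
    have lc: "lead_coeff p \<in> G" "lead_coeff p \<noteq> 0" using p by (auto simp: polys_over_coeff)
    then have u: "u \<in> G" unfolding u_def using inv[of "fst (lead_coeff p)" "snd (lead_coeff p)"] by simp
    have "fst (lead_coeff p) \<noteq> 0 \<and> snd (lead_coeff p) \<noteq> 0"
      using lc coherent_zero[OF G, of "fst (lead_coeff p)" "snd (lead_coeff p)"] by (auto simp: prod_eq_iff)
    then have "u * lead_coeff p = 1" unfolding u_def by (simp add: prod_eq_iff)
    moreover have "poly p (r, s) = 0"
      using fst_poly[of p "(r, s)"] snd_poly[of p "(r, s)"] fr s(3) by (simp add: prod_eq_iff f_def g_def)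
    ultimately obtain q' where q': "q' \<in> polys_over G" "degree q' < n" "poly q' (r, s) = poly q (r, s)"
      using reduce_modulo_polynomial[OF coherent_is_subring[OF G] p(1) _ p(3) n u _ q] by blast
    have "0 < poly (map_poly fst q') r \<longleftrightarrow> 0 < poly (map_poly snd q') s"
      using sign_transfer[OF rc G H r(2) s_notin cut q'(1) _ q'(2)] by (cases "q' = 0") auto
    then show "\<exists>q'\<in>polys_over G. poly q' (r, s) = poly q (r, s) \<and>
      (0 < poly (map_poly fst q') r \<longleftrightarrow> 0 < poly (map_poly snd q') s)"
      using q' by blast
  qed
  then show ?thesis using s(3) unfolding g_def by blast
qed

text \<open>
  The derivative does not vanish at \<open>r\<close>, which is not a root of any polynomial of smaller degree; if it is negative,
  replace \<open>p\<close> by \<open>- p\<close>.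
\<close>

lemma coherent_adjoin_algebraic:
  fixes G :: "('a::linordered_field \<times> 'a) set"
  assumes rc: "real_closed TYPE('a)" and G: "coherent G"
    and inv: "\<And>a b. (a, b) \<in> G \<Longrightarrow> (inverse a, inverse b) \<in> G"
    and H: "contains_roots_below n G" and p: "p \<in> polys_over G" "p \<noteq> 0" "degree p = n"
    and r: "poly (map_poly fst p) r = 0" "r \<notin> fst ` G"
  shows "\<exists>s. poly (map_poly snd p) s = 0 \<and> coherent (adjoin G (r, s))"
proof -
  obtain d where d: "d \<in> polys_over G" "map_poly fst d = pderiv (map_poly fst p)"
    using pderiv_of_pairs[OF coherent_is_subring[OF G] p(1)] by blast
  have deg: "degree (map_poly fst p) = n" "map_poly fst p \<noteq> 0"
    using coherent_degree[OF G p(1)] p by simp_all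
  have "n \<noteq> 0"
  proof
    assume "n = 0"
    then obtain c where "map_poly fst p = [:c:]" using deg(1) by (metis degree_eq_zeroE)
    then show False using r(1) deg(2) by simp
  qed
  have "poly (pderiv (map_poly fst p)) r \<noteq> 0"
  proof
    assume "poly (pderiv (map_poly fst p)) r = 0"
    moreover have "pderiv (map_poly fst p) \<noteq> 0" using deg(1) \<open>n \<noteq> 0\<close> by (simp add: pderiv_eq_0_iff)
    then have "d \<noteq> 0" using d(2) by auto
    moreover have "degree d < n"
      using coherent_degree(1)[OF G d(1)] \<open>n \<noteq> 0\<close> deg(1) unfolding d(2) by (simp add: degree_pderiv)
    ultimately show False using H d r(2) unfolding contains_roots_below_def by metis
  qed
  then consider "0 < poly (pderiv (map_poly fst p)) r" | "0 < poly (pderiv (map_poly fst (- p))) r"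
    by (cases "poly (pderiv (map_poly fst p)) r" "0 :: 'a" rule: linorder_cases)
      (auto simp: map_poly_prod_simps pderiv_minus)
  then show ?thesis
  proof cases
    case 1
    show ?thesis by (rule coherent_adjoin_algebraic_increasing[OF rc G inv H p r 1])
  next
    case 2
    have "- p \<in> polys_over G"
      using p(1) by (rule is_subringD(5)[OF is_subring_polys_over[OF coherent_is_subring[OF G]]])
    then have "\<exists>s. poly (map_poly snd (- p)) s = 0 \<and> coherent (adjoin G (r, s))"
      using p r by (intro coherent_adjoin_algebraic_increasing[OF rc G inv H _ _ _ _ r(2) 2])
        (auto simp: map_poly_prod_simps)
    then show ?thesis by (simp add: map_poly_prod_simps)
  qed
qed

subsection \<open>Maximal coherent sets\<close>

lemma is_subring_Union_chain:
  assumes chain: "\<And>A B. A \<in> \<C> \<Longrightarrow> B \<in> \<C> \<Longrightarrow> A \<subseteq> B \<or> B \<subseteq> A"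
    and "\<C> \<noteq> {}" and sub: "\<And>A. A \<in> \<C> \<Longrightarrow> is_subring A"
  shows "is_subring (\<Union>\<C>)"
  unfolding is_subring_def
proof (intro conjI ballI)
  show "0 \<in> \<Union>\<C>" "1 \<in> \<Union>\<C>" using assms(2) sub is_subringD(1,2) by blast+
  fix x assume "x \<in> \<Union>\<C>"
  then obtain A where A: "A \<in> \<C>" "x \<in> A" by blast
  then show "- x \<in> \<Union>\<C>" using is_subringD(5)[OF sub] by blast
  fix y assume "y \<in> \<Union>\<C>"
  then obtain B where B: "B \<in> \<C>" "y \<in> B" by blast
  obtain C where C: "C \<in> \<C>" "x \<in> C" "y \<in> C" using chain[OF A(1) B(1)] A B by blast
  show "x + y \<in> \<Union>\<C>" "x * y \<in> \<Union>\<C>"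
    using is_subringD(3)[OF sub[OF C(1)] C(2,3)] is_subringD(4)[OF sub[OF C(1)] C(2,3)] C(1) by blast+
qed

lemma coherent_Union_chain:
  assumes "\<And>A B. A \<in> \<C> \<Longrightarrow> B \<in> \<C> \<Longrightarrow> A \<subseteq> B \<or> B \<subseteq> A"
    and "\<C> \<noteq> {}" and coh: "\<And>A. A \<in> \<C> \<Longrightarrow> coherent A"
  shows "coherent (\<Union>\<C>)"
  unfolding coherent_def
proof
  show "is_subring (\<Union>\<C>)" using is_subring_Union_chain[OF assms(1,2)] coh coherent_is_subring by blast
  show "\<forall>(a, b)\<in>\<Union>\<C>. 0 < a \<longleftrightarrow> 0 < b" using coh unfolding coherent_def by blast
qed

lemma is_subring_Times: "is_subring A \<Longrightarrow> is_subring B \<Longrightarrow> is_subring (A \<times> B)"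
  by (auto simp: is_subring_def zero_prod_def one_prod_def)

lemma coherent_swap:
  assumes "coherent G"
  shows "coherent (prod.swap ` G)"
proof -
  note GR = is_subringD[OF coherent_is_subring[OF assms]]
  have swapI: "(b, a) \<in> prod.swap ` G" if "(a, b) \<in> G" for a b
    using imageI[OF that, of prod.swap] by simp
  have "is_subring (prod.swap ` G)"
    unfolding is_subring_def
  proof (intro conjI ballI)
    show "0 \<in> prod.swap ` G" "1 \<in> prod.swap ` G"
      using GR(1,2) by (auto simp: zero_prod_def one_prod_def intro: swapI)
    fix x assume "x \<in> prod.swap ` G"
    then obtain a b where x: "(a, b) \<in> G" "x = (b, a)" by auto
    then show "- x \<in> prod.swap ` G" using GR(5)[OF x(1)] swapI by simp
    fix y assume "y \<in> prod.swap ` G"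
    then obtain c d where y: "(c, d) \<in> G" "y = (d, c)" by auto
    show "x + y \<in> prod.swap ` G" "x * y \<in> prod.swap ` G"
      using GR(3)[OF x(1) y(1)] GR(4)[OF x(1) y(1)] swapI x(2) y(2) by simp_all
  qed
  moreover have "\<forall>(a, b)\<in>prod.swap ` G. 0 < a \<longleftrightarrow> 0 < b"
    using coherent_pos[OF assms] by fastforce
  ultimately show ?thesis by (simp add: coherent_def)
qed

definition pair_fractions :: "('a::linordered_field \<times> 'a) set \<Rightarrow> ('a \<times> 'a) set" where
  "pair_fractions G = {(u / a, v / b) | u v a b. (u, v) \<in> G \<and> (a, b) \<in> G \<and> a \<noteq> 0}"

lemma pair_fractionsI: "(u, v) \<in> G \<Longrightarrow> (a, b) \<in> G \<Longrightarrow> a \<noteq> 0 \<Longrightarrow> (u / a, v / b) \<in> pair_fractions G"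
  by (auto simp: pair_fractions_def)

text \<open>
  The sign of a quotient \<open>u / a\<close> is that of the product \<open>u * a\<close>. So a maximal coherent ring is closed under inverses.
\<close>

lemma coherent_pair_fractions:
  fixes G :: "('a::linordered_field \<times> 'a) set"
  assumes G: "coherent G"
  shows "coherent (pair_fractions G)" and "G \<subseteq> pair_fractions G"
proof -
  note GR = is_subringD[OF coherent_is_subring[OF G]]
  have one: "(1, 1) \<in> G" using GR(2) by (simp add: one_prod_def)
  show sub: "G \<subseteq> pair_fractions G"
  proof
    fix z assume "z \<in> G"
    then have "(fst z / 1, snd z / 1) \<in> pair_fractions G" using one by (intro pair_fractionsI) auto
    then show "z \<in> pair_fractions G" by simp
  qed
  show "coherent (pair_fractions G)"
    unfolding coherent_def is_subring_def
  proof (intro conjI ballI)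
    show "0 \<in> pair_fractions G" "1 \<in> pair_fractions G"
      using subsetD[OF sub GR(1)] subsetD[OF sub GR(2)] .
    fix x assume "x \<in> pair_fractions G"
    then obtain u v a b where x: "x = (u / a, v / b)" "(u, v) \<in> G" "(a, b) \<in> G" "a \<noteq> 0"
      unfolding pair_fractions_def by blast
    then have b: "b \<noteq> 0" using coherent_zero[OF G] by blast
    have "(- u, - v) \<in> G" using GR(5)[OF x(2)] by simp
    from pair_fractionsI[OF this x(3,4)] show "- x \<in> pair_fractions G" using x(1) by simp
    have "(u * a, v * b) \<in> G" using GR(4)[OF x(2,3)] by simp
    then have "0 < u * a \<longleftrightarrow> 0 < v * b" by (rule coherent_pos[OF G])
    then show "case x of (a, b) \<Rightarrow> 0 < a \<longleftrightarrow> 0 < b"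
      using x(1) by (simp add: zero_less_divide_iff zero_less_mult_iff)
    fix y assume "y \<in> pair_fractions G"
    then obtain u' v' a' b' where y: "y = (u' / a', v' / b')" "(u', v') \<in> G" "(a', b') \<in> G" "a' \<noteq> 0"
      unfolding pair_fractions_def by blast
    then have b': "b' \<noteq> 0" using coherent_zero[OF G] by blast
    have aa: "(a * a', b * b') \<in> G" using GR(4)[OF x(3) y(3)] by simp
    have nz: "a * a' \<noteq> 0" using x(4) y(4) by simp
    have "(u * a' + u' * a, v * b' + v' * b) \<in> G"
      using GR(3)[OF GR(4)[OF x(2) y(3)] GR(4)[OF y(2) x(3)]] by simp
    from pair_fractionsI[OF this aa nz] show "x + y \<in> pair_fractions G"
      using x(1,4) y(1,4) b b' by (simp add: add_frac_eq)
    have "(u * u', v * v') \<in> G" using GR(4)[OF x(2) y(2)] by simp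
    from pair_fractionsI[OF this aa nz] show "x * y \<in> pair_fractions G"
      using x(1) y(1) by simp
  qed
qed

lemma adjoin_pair_subset_Times:
  assumes "G \<subseteq> A \<times> B" "is_subring A" "is_subring B" "r \<in> A" "s \<in> B"
  shows "adjoin G (r, s) \<subseteq> A \<times> B"
  using assms by (intro adjoin_minimal is_subring_Times) auto

lemma maximal_coherent_exists:
  fixes G0 :: "('a::linordered_field \<times> 'a) set"
  assumes G0: "coherent G0" "G0 \<subseteq> A \<times> B"
  shows "\<exists>G. coherent G \<and> G0 \<subseteq> G \<and> G \<subseteq> A \<times> B \<and> (\<forall>H. coherent H \<longrightarrow> G \<subseteq> H \<longrightarrow> H \<subseteq> A \<times> B \<longrightarrow> H = G)"
proof -
  define \<A> where "\<A> = {G. coherent G \<and> G0 \<subseteq> G \<and> G \<subseteq> A \<times> B}"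
  have "\<exists>M\<in>\<A>. \<forall>X\<in>\<A>. M \<subseteq> X \<longrightarrow> X = M"
  proof (rule subset_Zorn_nonempty)
    show "\<A> \<noteq> {}" using G0 by (auto simp: \<A>_def)
    fix \<C> assume C: "\<C> \<noteq> {}" "subset.chain \<A> \<C>"
    have "coherent (\<Union>\<C>)"
      using C unfolding subset_chain_def \<A>_def by (intro coherent_Union_chain) blast+
    moreover have "G0 \<subseteq> \<Union>\<C>" "\<Union>\<C> \<subseteq> A \<times> B"
      using C unfolding subset_chain_def \<A>_def by blast+
    ultimately show "\<Union>\<C> \<in> \<A>" by (simp add: \<A>_def)
  qed
  then obtain G where "G \<in> \<A>" and max: "\<forall>X\<in>\<A>. G \<subseteq> X \<longrightarrow> X = G" by (rule bexE)
  then have G: "coherent G" "G0 \<subseteq> G" "G \<subseteq> A \<times> B" by (simp_all add: \<A>_def)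
  have "H = G" if "coherent H" "G \<subseteq> H" "H \<subseteq> A \<times> B" for H
    using max that G(2) unfolding \<A>_def by blast
  then show ?thesis using G by blast
qed

lemma map_poly_swap:
  fixes p :: "('a::comm_ring_1 \<times> 'a) poly"
  shows "map_poly fst (map_poly prod.swap p) = map_poly snd p"
    "map_poly snd (map_poly prod.swap p) = map_poly fst p"
    "degree (map_poly prod.swap p) = degree p" "map_poly prod.swap p = 0 \<longleftrightarrow> p = 0"
proof -
  have 0: "prod.swap z = 0 \<longleftrightarrow> z = 0" for z :: "'a \<times> 'a" by (cases z) (auto simp: zero_prod_def)
  then have s0: "prod.swap (0 :: 'a \<times> 'a) = 0" by blast
  show "map_poly fst (map_poly prod.swap p) = map_poly snd p"
    "map_poly snd (map_poly prod.swap p) = map_poly fst p"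
    using s0 by (simp_all add: poly_eq_iff coeff_map_poly)
  show "degree (map_poly prod.swap p) = degree p" "map_poly prod.swap p = 0 \<longleftrightarrow> p = 0"
    by (simp_all add: Polynomial.degree_def poly_eq_iff coeff_map_poly s0 0)
qed

lemma map_poly_swap_in_polys_over:
  fixes p :: "('a::comm_ring_1 \<times> 'a) poly"
  assumes "p \<in> polys_over G"
  shows "map_poly prod.swap p \<in> polys_over (prod.swap ` G)"
proof -
  have "prod.swap (0 :: 'a \<times> 'a) = 0" by (simp add: zero_prod_def)
  then show ?thesis using assms by (simp add: polys_over_def coeff_map_poly)
qed

lemma contains_roots_below_swap:
  assumes "contains_roots_below n G"
  shows "contains_roots_below n (prod.swap ` G)"
  unfolding contains_roots_below_def
proof (intro ballI impI)
  fix p assume p: "p \<in> polys_over (prod.swap ` G)" "p \<noteq> 0" "degree p < n"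
  define q where "q = map_poly prod.swap p"
  have "prod.swap ` prod.swap ` G = G" by force
  then have "q \<in> polys_over G" using map_poly_swap_in_polys_over[OF p(1)] by (simp add: q_def)
  moreover have "q \<noteq> 0" "degree q < n" using p map_poly_swap[of p] by (simp_all add: q_def)
  ultimately have "(\<forall>a. poly (map_poly fst q) a = 0 \<longrightarrow> a \<in> fst ` G) \<and> (\<forall>b. poly (map_poly snd q) b = 0 \<longrightarrow> b \<in> snd ` G)"
    using assms unfolding contains_roots_below_def by blast
  then show "(\<forall>a. poly (map_poly fst p) a = 0 \<longrightarrow> a \<in> fst ` prod.swap ` G) \<and> (\<forall>b. poly (map_poly snd p) b = 0 \<longrightarrow> b \<in> snd ` prod.swap ` G)"
    unfolding q_def map_poly_swap by (simp add: image_image)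
qed

lemma polys_over_fst_subset:
  assumes "p \<in> polys_over G" "G \<subseteq> A \<times> B"
  shows "map_poly fst p \<in> polys_over A" "map_poly snd p \<in> polys_over B"
  using assms by (auto simp: polys_over_def coeff_map_poly) (metis mem_Times_iff subsetD)+

text \<open>
  By induction on the degree: a root missing in the first projection could be adjoined together with a suitable partner,
  against maximality, and a root missing in the second one likewise after exchanging the components. That \<open>A\<close> and
  \<open>B\<close> are relatively algebraically closed guarantees that the enlarged set stays within \<open>A \<times> B\<close>.
\<close>

lemma maximal_coherent_contains_roots:
  fixes G :: "('a::linordered_field \<times> 'a) set"
  assumes rc: "real_closed TYPE('a)" and G: "coherent G" "G \<subseteq> A \<times> B" and A: "rac A" and B: "rac B"
    and max: "\<And>H. coherent H \<Longrightarrow> G \<subseteq> H \<Longrightarrow> H \<subseteq> A \<times> B \<Longrightarrow> H = G"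
  shows "contains_roots_below n G"
proof (induction n)
  case 0
  show ?case by (simp add: contains_roots_below_def)
next
  case (Suc n)
  have "pair_fractions G = G"
  proof (rule max[OF coherent_pair_fractions[OF G(1)]])
    show "pair_fractions G \<subseteq> A \<times> B"
      using G(2) subfield_divide[OF rac_is_subfield[OF A]] subfield_divide[OF rac_is_subfield[OF B]]
      unfolding pair_fractions_def by blast
  qed
  then have inv: "(inverse a, inverse b) \<in> G" if "(a, b) \<in> G" for a b
  proof (cases "a = 0")
    case True
    then show ?thesis using that coherent_zero[OF G(1) that] by simp
  next
    case False
    have "(1, 1) \<in> G" using is_subringD(2)[OF coherent_is_subring[OF G(1)]] by (simp add: one_prod_def)
    then have "(1 / a, 1 / b) \<in> pair_fractions G" using that False by (rule pair_fractionsI)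
    then show ?thesis using \<open>pair_fractions G = G\<close> by (simp add: inverse_eq_divide)
  qed
  have adjoin_G: "adjoin G (r, s) = G" if "coherent (adjoin G (r, s))" "r \<in> A" "s \<in> B" for r s
    using insert_subset_adjoin[OF coherent_is_subring[OF G(1)]] that
    by (intro max adjoin_pair_subset_Times G rac_is_subring A B) auto
  have root_fst: "r \<in> fst ` G" if p: "p \<in> polys_over G" "p \<noteq> 0" "degree p = n" "poly (map_poly fst p) r = 0" for p r
  proof (rule ccontr)
    assume r: "r \<notin> fst ` G"
    obtain s where s: "poly (map_poly snd p) s = 0" "coherent (adjoin G (r, s))"
      using coherent_adjoin_algebraic[OF rc G(1) inv Suc.IH p r] by blast
    have "r \<in> A" "s \<in> B"
      using rac_root[OF A polys_over_fst_subset(1)[OF p(1) G(2)]] rac_root[OF B polys_over_fst_subset(2)[OF p(1) G(2)]]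
        p(2,4) s(1) coherent_degree[OF G(1) p(1)] by auto
    then have "(r, s) \<in> G"
      using adjoin_G[OF s(2)] insert_subset_adjoin[OF coherent_is_subring[OF G(1)], of "(r, s)"] by auto
    then show False using r by force
  qed
  have root_snd: "s \<in> snd ` G" if p: "p \<in> polys_over G" "p \<noteq> 0" "degree p = n" "poly (map_poly snd p) s = 0" for p s
  proof (rule ccontr)
    assume s: "s \<notin> snd ` G"
    define G' where "G' = prod.swap ` G"
    define q where "q = map_poly prod.swap p"
    have G': "coherent G'" "contains_roots_below n G'"
      unfolding G'_def using coherent_swap[OF G(1)] contains_roots_below_swap[OF Suc.IH] by auto
    have q: "q \<in> polys_over G'" "q \<noteq> 0" "degree q = n" "poly (map_poly fst q) s = 0"
      using p map_poly_swap[of p] map_poly_swap_in_polys_over[OF p(1)] by (simp_all add: q_def G'_def)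
    have s': "s \<notin> fst ` G'" using s by (force simp: G'_def)
    have inv': "(inverse a, inverse b) \<in> G'" if "(a, b) \<in> G'" for a b
      using that inv unfolding G'_def by force
    obtain r where r: "poly (map_poly snd q) r = 0" "coherent (adjoin G' (s, r))"
      using coherent_adjoin_algebraic[OF rc G'(1) inv' G'(2) q s'] by blast
    have fq: "poly (map_poly fst p) r = 0" using r(1) map_poly_swap(2)[of p] by (simp add: q_def)
    have AB: "r \<in> A" "s \<in> B"
      using rac_root[OF A polys_over_fst_subset(1)[OF p(1) G(2)]] rac_root[OF B polys_over_fst_subset(2)[OF p(1) G(2)]]
        p(2,4) fq coherent_degree[OF G(1) p(1)] by auto
    have "G' \<subseteq> B \<times> A" using G(2) by (auto simp: G'_def)
    then have "adjoin G' (s, r) \<subseteq> B \<times> A"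
      using AB rac_is_subring A B by (intro adjoin_pair_subset_Times) auto
    then have "prod.swap ` adjoin G' (s, r) \<subseteq> A \<times> B" by auto
    moreover have ins: "insert (s, r) G' \<subseteq> adjoin G' (s, r)"
      by (rule insert_subset_adjoin[OF coherent_is_subring[OF G'(1)]])
    then have "prod.swap ` insert (s, r) G' \<subseteq> prod.swap ` adjoin G' (s, r)" by (rule image_mono)
    then have "insert (r, s) G \<subseteq> prod.swap ` adjoin G' (s, r)" by (simp add: G'_def image_image)
    ultimately have "(r, s) \<in> G"
      using max[OF coherent_swap[OF r(2)]] by auto
    then show False using s by force
  qed
  show ?case
    using Suc.IH root_fst root_snd unfolding contains_roots_below_def less_Suc_eq by blast
qed


section \<open>The transfinite construction\<close>

text \<open>
  The invariant of the recursion: \<open>P\<close> induces an order isomorphism of the generated rings, and \<open>t\<close> is not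
  algebraic over the values of \<open>P\<close>.
\<close>

definition extendible :: "'a::linordered_field \<Rightarrow> ('a \<times> 'a) set \<Rightarrow> bool" where
  "extendible t P \<longleftrightarrow> coherent (is_subring hull P) \<and> t \<notin> rac hull (snd ` P)"

lemma is_subring_hull: "is_subring (is_subring hull P)"
  by (rule hull_in) (auto simp: is_subring_def)

lemma subring_hull_minimal: "P \<subseteq> G \<Longrightarrow> is_subring G \<Longrightarrow> is_subring hull P \<subseteq> G"
  by (rule hull_minimal[where S = is_subring])

lemma rac_hull_minimal: "P \<subseteq> K \<Longrightarrow> rac K \<Longrightarrow> rac hull P \<subseteq> K"
  by (rule hull_minimal[where S = rac])

lemma extendible_if_subset:
  assumes "coherent G" "P \<subseteq> G" "t \<notin> rac hull (snd ` P)"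
  shows "extendible t P"
  unfolding extendible_def
  using coherent_subset[OF assms(1) is_subring_hull subring_hull_minimal[OF assms(2) coherent_is_subring[OF assms(1)]]] assms(3)
  by blast

lemma extendible_empty: "t \<notin> rac hull {} \<Longrightarrow> extendible t {}"
proof (rule extendible_if_subset[of "range (\<lambda>a. (a, a))"])
  show "coherent (range (\<lambda>a::'a. (a, a)))"
    by (auto simp: coherent_def is_subring_def zero_prod_def one_prod_def)
qed auto

text \<open>
  Both parts of the invariant have finite character: the union of the chain of generated rings is a coherent
  ring, and the union of the hulls of the sets of values is relatively algebraically closed.
\<close>

lemma extendible_Union_chain:
  assumes chain: "\<And>A B. A \<in> \<C> \<Longrightarrow> B \<in> \<C> \<Longrightarrow> A \<subseteq> B \<or> B \<subseteq> A"
    and ne: "\<C> \<noteq> {}" and ext: "\<And>A. A \<in> \<C> \<Longrightarrow> extendible t A"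
  shows "extendible t (\<Union>\<C>)"
proof (rule extendible_if_subset)
  define \<G> where "\<G> = (\<lambda>A. is_subring hull A) ` \<C>"
  show "coherent (\<Union>\<G>)"
  proof (rule coherent_Union_chain)
    fix G H assume "G \<in> \<G>" "H \<in> \<G>"
    then obtain A B where AB: "A \<in> \<C>" "B \<in> \<C>" "G = is_subring hull A" "H = is_subring hull B"
      unfolding \<G>_def by blast
    show "G \<subseteq> H \<or> H \<subseteq> G"
      using chain[OF AB(1,2)] hull_mono[of A B is_subring] hull_mono[of B A is_subring] unfolding AB(3,4) by blast
  next
    show "coherent G" if "G \<in> \<G>" for G
      using that ext unfolding extendible_def \<G>_def by blast
  qed (use ne in \<open>simp add: \<G>_def\<close>)
  show "\<Union>\<C> \<subseteq> \<Union>\<G>"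
  proof
    fix z assume "z \<in> \<Union>\<C>"
    then obtain A where A: "A \<in> \<C>" "z \<in> A" by blast
    then have "z \<in> is_subring hull A" using hull_subset[of A is_subring] by blast
    then show "z \<in> \<Union>\<G>" using A(1) unfolding \<G>_def by blast
  qed
  define \<R> where "\<R> = (\<lambda>A. rac hull (snd ` A)) ` \<C>"
  have "rac (\<Union>\<R>)"
  proof (rule rac_Union_chain)
    fix K L assume "K \<in> \<R>" "L \<in> \<R>"
    then obtain A B where AB: "A \<in> \<C>" "B \<in> \<C>" "K = rac hull (snd ` A)" "L = rac hull (snd ` B)"
      unfolding \<R>_def by blast
    show "K \<subseteq> L \<or> L \<subseteq> K"
      using chain[OF AB(1,2)] hull_mono[of "snd ` A" "snd ` B" rac] hull_mono[of "snd ` B" "snd ` A" rac]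
        image_mono[of A B snd] image_mono[of B A snd] unfolding AB(3,4) by blast
  next
    show "rac K" if "K \<in> \<R>" for K using that rac_hull unfolding \<R>_def by blast
  qed (use ne in \<open>simp add: \<R>_def\<close>)
  moreover have "snd ` \<Union>\<C> \<subseteq> \<Union>\<R>"
  proof
    fix b assume "b \<in> snd ` \<Union>\<C>"
    then obtain A where "A \<in> \<C>" "b \<in> snd ` A" by blast
    then have "b \<in> rac hull (snd ` A)" using hull_subset[of "snd ` A" rac] by blast
    then show "b \<in> \<Union>\<R>" using \<open>A \<in> \<C>\<close> unfolding \<R>_def by blast
  qed
  ultimately have "rac hull (snd ` \<Union>\<C>) \<subseteq> \<Union>\<R>" by (intro rac_hull_minimal)
  moreover have "t \<notin> \<Union>\<R>" using ext unfolding \<R>_def extendible_def by blast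
  ultimately show "t \<notin> rac hull (snd ` \<Union>\<C>)" by blast
qed

text \<open>
  The step of the recursion. The values generate \<open>B\<close>, and together with \<open>t\<close> they generate \<open>L\<close>, which is still
  smaller than \<open>\<kappa>\<close>. The new value has to lie in the cut \<open>(B1, B2)\<close> corresponding to that of \<open>x\<close>, but outside
  \<open>L\<close>. Both are achieved by asking for \<open>y\<close> above all elements of \<open>L\<close> below \<open>B2\<close>, instead of only above \<open>B1\<close>: if
  \<open>y\<close> were in \<open>L\<close>, it would be above itself. By exchange, \<open>t\<close> is then transcendental over \<open>B(y)\<close>.
\<close>

lemma extendible_insert:
  fixes P :: "('a::linordered_field \<times> 'a) set" and \<kappa> :: "'c rel"
  assumes rc: "real_closed TYPE('a)" and eta: "eta_set \<kappa> (UNIV :: 'a set)"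
    and \<kappa>: "Card_order \<kappa>" "|UNIV :: nat set| <o \<kappa>"
    and P: "extendible t P" "|P| <o \<kappa>"
  shows "\<exists>y. extendible t (insert (x, y) P)"
proof -
  define A B where "A = rac hull (fst ` P)" and "B = rac hull (snd ` P)"
  have AB: "rac A" "rac B" unfolding A_def B_def by (rule rac_hull)+
  have "P \<subseteq> A \<times> B"
    unfolding A_def B_def using hull_subset[of "fst ` P" rac] hull_subset[of "snd ` P" rac] by force
  then have "is_subring hull P \<subseteq> A \<times> B"
    using AB rac_is_subring by (intro subring_hull_minimal is_subring_Times)
  moreover have "coherent (is_subring hull P)" "t \<notin> B" using P by (simp_all add: extendible_def B_def)
  ultimately obtain G where G: "coherent G" "is_subring hull P \<subseteq> G" "G \<subseteq> A \<times> B"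
      and max: "\<forall>H. coherent H \<longrightarrow> G \<subseteq> H \<longrightarrow> H \<subseteq> A \<times> B \<longrightarrow> H = G"
    using maximal_coherent_exists by metis
  have PG: "P \<subseteq> G" using G(2) hull_subset[of P is_subring] by blast
  have splits: "contains_roots_below n G" for n
    using maximal_coherent_contains_roots[OF rc G(1,3) AB] max by blast
  have sndG: "snd ` G \<subseteq> B" using G(3) by auto
  show ?thesis
  proof (cases "x \<in> fst ` G")
    case True
    then obtain y where y: "(x, y) \<in> G" by force
    have "snd ` insert (x, y) P \<subseteq> B"
      using y sndG hull_subset[of "snd ` P" rac] by (force simp: B_def)
    then have "rac hull (snd ` insert (x, y) P) \<subseteq> B" using AB(2) by (rule rac_hull_minimal)
    then show ?thesis
      using extendible_if_subset[OF G(1), of "insert (x, y) P" t] y PG \<open>t \<notin> B\<close> by blast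
  next
    case False
    define L where "L = rac hull (insert t B)"
    have BL: "B \<subseteq> L" unfolding L_def using hull_subset[of "insert t B" rac] by blast
    have inf: "infinite (Field \<kappa>)"
      using \<kappa> by (metis card_of_Field_ordIso card_of_ordLeq_infinite infinite_UNIV_nat ordLess_imp_ordLeq ordLess_ordIso_trans ordIso_symmetric)
    have "|snd ` P| <o \<kappa>" using P(2) card_of_image ordLeq_ordLess_trans by blast
    then have "|B| <o \<kappa>" unfolding B_def by (rule card_rac_hull_less[OF _ \<kappa>(2,1)])
    moreover have "|{t}| <o \<kappa>"
      using inf \<kappa>(1) by (metis card_of_Well_order card_order_on_well_order_on finite.emptyI finite.insertI finite_ordLess_infinite Field_card_of)
    ultimately have "|{t} \<union> B| <o \<kappa>" using card_of_Un_ordLess_infinite_Field[OF inf \<kappa>(1)] by blast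
    then have L: "|L| <o \<kappa>" unfolding L_def using card_rac_hull_less[OF _ \<kappa>(2,1)] by simp
    define B1 B2 where "B1 = {b. \<exists>a. (a, b) \<in> G \<and> a < x}" and "B2 = {b. \<exists>a. (a, b) \<in> G \<and> x < a}"
    define C where "C = B1 \<union> {z\<in>L. \<forall>b\<in>B2. z < b}"
    have "B1 \<subseteq> L" "B2 \<subseteq> L" using sndG BL unfolding B1_def B2_def by force+
    then have "C \<subseteq> L" by (auto simp: C_def)
    have "|C| <o \<kappa>" "|B2| <o \<kappa>"
      using L card_of_mono1[OF \<open>C \<subseteq> L\<close>] card_of_mono1[OF \<open>B2 \<subseteq> L\<close>] ordLeq_ordLess_trans by blast+
    moreover have "\<forall>c\<in>C. \<forall>b\<in>B2. c < b"
    proof (intro ballI)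
      fix c b assume cb: "c \<in> C" "b \<in> B2"
      show "c < b"
      proof (cases "c \<in> B1")
        case True
        then obtain a a' where "(a, c) \<in> G" "(a', b) \<in> G" "a < x" "x < a'"
          using cb unfolding B1_def B2_def by blast
        then show ?thesis using coherent_less[OF G(1)] by (meson less_trans)
      qed (use cb in \<open>auto simp: C_def\<close>)
    qed
    ultimately obtain y where y: "\<forall>c\<in>C. c < y" "\<forall>b\<in>B2. y < b"
      using eta unfolding eta_set_def by (metis subset_UNIV)
    have yL: "y \<notin> L"
    proof
      assume "y \<in> L"
      then have "y \<in> C" using y(2) by (simp add: C_def)
      then show False using y(1) by blast
    qed
    have "a < x \<longleftrightarrow> b < y" if ab: "(a, b) \<in> G" for a b
    proof -
      have "a \<noteq> x" using ab False by force
      then consider "a < x" | "x < a" by fastforce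
      then show ?thesis
      proof cases
        case 1
        then have "b \<in> C" using ab by (auto simp: C_def B1_def)
        then show ?thesis using y 1 by blast
      next
        case 2
        then have "b \<in> B2" using ab by (auto simp: B2_def)
        then show ?thesis using y 2 by (meson order_less_asym)
      qed
    qed
    moreover have "y \<notin> snd ` G" using yL sndG BL by blast
    ultimately have coh: "coherent (adjoin G (x, y))"
      using coherent_adjoin_transcendental[OF rc G(1) splits False] by blast
    have "insert (x, y) P \<subseteq> adjoin G (x, y)"
      using PG insert_subset_adjoin[OF coherent_is_subring[OF G(1)], of "(x, y)"] by blast
    moreover have "t \<notin> rac hull (insert y B)"
      using rac_exchange[OF AB(2) \<open>t \<notin> B\<close>] yL unfolding L_def by blast
    moreover have "rac hull (snd ` insert (x, y) P) \<subseteq> rac hull (insert y B)"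
      by (rule hull_mono) (use hull_subset[of "snd ` P" rac] in \<open>auto simp: B_def\<close>)
    ultimately show ?thesis using extendible_if_subset[OF coh] by blast
  qed
qed

text \<open>
  An initial segment of the well-order has fewer than \<open>\<kappa>\<close> elements, so the step applies at each stage; the
  graph on an initial segment is the union of the chain of graphs on the smaller closed ones. An
  element \<open>t\<close> to start with exists because the hull of the empty set is smaller than \<open>\<kappa>\<close>.
\<close>

lemma extendible_graph_exists:
  fixes \<kappa> :: "'c rel"
  assumes rc: "real_closed TYPE('a::linordered_field)" and eta: "eta_set \<kappa> (UNIV :: 'a set)"
    and \<kappa>: "Card_order \<kappa>" "|UNIV :: nat set| <o \<kappa>" and card: "|UNIV :: 'a set| =o \<kappa>"
  shows "\<exists>(f :: 'a \<Rightarrow> 'a) t. extendible t (range (\<lambda>x. (x, f x)))"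
proof -
  have "|{} :: 'a set| <o \<kappa>"
    using \<kappa>(2) card_of_empty ordLeq_ordLess_trans by blast
  then have "|rac hull ({} :: 'a set)| <o \<kappa>" by (rule card_rac_hull_less[OF _ \<kappa>(2,1)])
  then have "rac hull ({} :: 'a set) \<noteq> UNIV"
    using card not_ordLess_ordIso by metis
  then obtain t :: 'a where t: "t \<notin> rac hull {}" by blast
  define r where "r = |UNIV :: 'a set|"
  have wo: "Well_order r" "Field r = UNIV" unfolding r_def by simp_all
  define R where "R = r - Id"
  have "wf R" using wo unfolding R_def well_order_on_def by blast
  interpret wo_rel r using wo by (simp add: wo_rel_def)
  have R_trans: "(x, z) \<in> R" if "(x, y) \<in> R" "(y, z) \<in> R" for x y z
    using that TRANS ANTISYM unfolding R_def trans_def antisym_def by blast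
  have R_total: "(x, y) \<in> R \<or> (y, x) \<in> R \<or> x = y" for x y
    using TOTAL wo(2) unfolding R_def total_on_def by blast
  define graph where "graph f x = {(z, f z) | z. (z, x) \<in> R}" for f :: "'a \<Rightarrow> 'a" and x
  have graph_card: "|graph f x| <o \<kappa>" for f x
  proof -
    have "graph f x = (\<lambda>z. (z, f z)) ` Order_Relation.underS r x"
      by (auto simp: graph_def R_def Order_Relation.underS_def)
    then have "|graph f x| \<le>o |Order_Relation.underS r x|" by (simp add: card_of_image)
    also have "|Order_Relation.underS r x| <o r" unfolding r_def by (rule card_of_underS) (simp_all add: wo)
    also have "r =o \<kappa>" unfolding r_def by (rule card)
    finally show ?thesis .
  qed
  define Q where "Q f x y \<longleftrightarrow> (extendible t (graph f x) \<longrightarrow> extendible t (insert (x, y) (graph f x)))" for f x y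
  \<comment> \<open>The choice at \<open>x\<close> depends only on the values before \<open>x\<close>. That these satisfy the invariant is a premise inside
    \<open>Q\<close>, since at limit stages it follows from the values chosen at all earlier stages and not from the last one.\<close>
  have "\<exists>f. \<forall>x. Q f x (f x)"
  proof (rule dependent_wf_choice[OF \<open>wf R\<close>])
    fix f g :: "'a \<Rightarrow> 'a" and x y
    assume "\<And>z. (z, x) \<in> R \<Longrightarrow> f z = g z"
    then have "graph f x = graph g x" unfolding graph_def by force
    then show "Q f x y = Q g x y" by (simp add: Q_def)
  next
    fix f x
    show "\<exists>y. Q f x y"
      unfolding Q_def using extendible_insert[OF rc eta \<kappa> _ graph_card] by blast
  qed
  then obtain f where f: "\<And>x. Q f x (f x)" by blast
  have Union: "extendible t (\<Union>x\<in>Z. insert (x, f x) (graph f x))"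
    if Z: "\<And>x. x \<in> Z \<Longrightarrow> extendible t (graph f x)" for Z
  proof (cases "Z = {}")
    case True
    then show ?thesis using extendible_empty[OF t] by simp
  next
    case False
    have closed: "insert (x, f x) (graph f x) = (\<lambda>z. (z, f z)) ` {z. (z, x) \<in> R \<or> z = x}" for x
      by (auto simp: graph_def)
    have "insert (x, f x) (graph f x) \<subseteq> insert (y, f y) (graph f y)" if "(x, y) \<in> R \<or> x = y" for x y
      unfolding closed using that R_trans by (intro image_mono) blast
    then have chain: "insert (x, f x) (graph f x) \<subseteq> insert (y, f y) (graph f y) \<or>
        insert (y, f y) (graph f y) \<subseteq> insert (x, f x) (graph f x)" for x y
      using R_total[of x y] by blast
    have "extendible t (insert (x, f x) (graph f x))" if "x \<in> Z" for x
      using f[of x] Z[OF that] by (simp add: Q_def)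
    then show ?thesis
      using False chain by (intro extendible_Union_chain) auto
  qed
  have all: "extendible t (graph f x)" for x
    using \<open>wf R\<close>
  proof (induction x rule: wf_induct_rule)
    case (less x)
    have "graph f x = (\<Union>z\<in>{z. (z, x) \<in> R}. insert (z, f z) (graph f z))"
    proof (intro equalityI UN_least)
      show "insert (z, f z) (graph f z) \<subseteq> graph f x" if "z \<in> {z. (z, x) \<in> R}" for z
        using that R_trans[of _ z x] unfolding graph_def by auto
    qed (auto simp: graph_def)
    then show ?case using Union[of "{z. (z, x) \<in> R}"] less by simp
  qed
  have "range (\<lambda>x. (x, f x)) = (\<Union>x\<in>UNIV. insert (x, f x) (graph f x))"
    by (auto simp: graph_def)
  then have "extendible t (range (\<lambda>x. (x, f x)))"
    using Union[of UNIV] all by (simp only:)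
  then show ?thesis by blast
qed

text \<open>
  The first cardinal in the hierarchy below \<open>\<kappa>\<close> is infinite, and \<open>\<kappa>\<close> is strictly above it.
\<close>

lemma is_aleph_uncountable:
  assumes "is_aleph \<alpha> \<kappa>" "Field \<alpha> \<noteq> {}"
  shows "Card_order \<kappa>" "|UNIV :: nat set| <o \<kappa>"
proof -
  obtain h where h: "\<forall>i\<in>Field \<alpha>. least_infinite_cardinal_above (h ` underS \<alpha> i) (h i)"
      "least_infinite_cardinal_above (h ` Field \<alpha>) \<kappa>"
    using assms(1) unfolding is_aleph_def by blast
  show "Card_order \<kappa>" using h(2) by (simp add: least_infinite_cardinal_above_def)
  obtain i where i: "i \<in> Field \<alpha>" using assms(2) by blast
  then have hi: "Card_order (h i)" "infinite (Field (h i))" "h i <o \<kappa>"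
    using h by (simp_all add: least_infinite_cardinal_above_def)
  have "|UNIV :: nat set| \<le>o |Field (h i)|" using hi(2) infinite_iff_card_of_nat by blast
  also have "|Field (h i)| =o h i" using hi(1) by (rule card_of_Field_ordIso)
  also have "h i <o \<kappa>" by (rule hi(3))
  finally show "|UNIV :: nat set| <o \<kappa>" .
qed

text \<open>
  In a coherent ring the first component determines the second. As the ring generated by the graph contains
  with \<open>(x, f x)\<close> and \<open>(y, f y)\<close> also their sum and product, \<open>f\<close> is a homomorphism.
\<close>

lemma embedding_of_extendible_graph:
  fixes f :: "'a::linordered_field \<Rightarrow> 'a"
  assumes ext: "extendible t (range (\<lambda>x. (x, f x)))"
  shows "is_subfield (range f)" "range f \<subset> UNIV" "field_iso f UNIV (range f)"
proof -
  define G where "G = is_subring hull (range (\<lambda>x. (x, f x)))"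
  have G: "coherent G" using ext by (simp add: extendible_def G_def)
  note GR = is_subringD[OF coherent_is_subring[OF G]]
  have mem: "(x, f x) \<in> G" for x unfolding G_def using hull_subset[of "range (\<lambda>x. (x, f x))" is_subring] by blast
  have f: "f x = y" if "(x, y) \<in> G" for x y
    using coherent_eq[OF G that mem[of x]] by simp
  have zero: "f 0 = 0" using f GR(1) by (simp add: zero_prod_def)
  have one: "f 1 = 1" using f GR(2) by (simp add: one_prod_def)
  have add: "f (x + y) = f x + f y" for x y using f GR(3)[OF mem mem, of x y] by simp
  have mult: "f (x * y) = f x * f y" for x y using f GR(4)[OF mem mem, of x y] by simp
  have minus: "f (- x) = - f x" for x using f GR(5)[OF mem, of x] by simp
  have inv: "f (inverse x) = inverse (f x)" for x
  proof (cases "x = 0")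
    case False
    then have "f (inverse x) * f x = 1" using mult[of "inverse x" x] one by simp
    then show ?thesis by (metis inverse_unique mult.commute)
  qed (simp add: zero)
  show "is_subfield (range f)"
    unfolding is_subfield_def
    using rangeI[of f 0] rangeI[of f 1] by (auto simp: zero one simp flip: add mult minus inv)
  show "range f \<subset> UNIV"
  proof -
    have "range f \<subseteq> rac hull (snd ` range (\<lambda>x. (x, f x)))"
      using hull_subset[of "snd ` range (\<lambda>x. (x, f x))" rac] by (simp add: image_image)
    then have "t \<notin> range f" using ext unfolding extendible_def by blast
    then show ?thesis by blast
  qed
  have "inj f"
  proof (rule injI)
    show "x = y" if "f x = f y" for x y
      using coherent_eq[OF G mem[of x] mem[of y]] that by simp
  qed
  then show "field_iso f UNIV (range f)"
    unfolding field_iso_def using one add mult by (auto simp: bij_betw_def)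
qed

theorem theorem2p2:
  fixes \<alpha> :: "'b rel" and \<kappa> :: "'c rel"
  assumes "Well_order \<alpha>" and "Field \<alpha> \<noteq> {}"
    and "is_aleph \<alpha> \<kappa>"
    and "real_closed TYPE('a::linordered_field)"
    and "eta_set \<kappa> (UNIV :: 'a set)"
    and "|UNIV :: 'a set| =o \<kappa>"
  shows "\<exists>(F' :: 'a set) \<phi>. is_subfield F' \<and> F' \<subset> UNIV \<and> field_iso \<phi> (UNIV :: 'a set) F'"
proof -
  note \<kappa> = is_aleph_uncountable[OF assms(3,2)]
  obtain f :: "'a \<Rightarrow> 'a" and t where f: "extendible t (range (\<lambda>x. (x, f x)))"
    using extendible_graph_exists[OF assms(4,5) \<kappa> assms(6)] by blast
  show ?thesis
    using embedding_of_extendible_graph[OF f] by (intro exI[of _ "range f"] exI[of _ f] conjI)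
qed

end
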